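(* Let $\ell\ge1$ be an integer and $a\in\mathbb C^*$. Then $V(Y_{\ell,a}Y_{0,aq^\ell}^{-1})$ is an extremal loop weight $\mathcal U_q(\hat{sl}_\infty)$-module generated by the vector $(1<2<\cdots<\ell)_a$ of $\ell$-weight $Y_{\ell,a}Y_{0,aq^\ell}^{-1}$.
   Context: Algebra. Fix $t\in\mathbb C$ such that $q=e^{t}$ is not a root of unity, and put $q^{r}=e^{tr}$ for $r\in\mathbb Q$. For $i,j\in\mathbb Z$ let $C_{ii}=2$, $C_{i,i\pm1}=-1$, $C_{ij}=0$ otherwise; $\mathfrak h=\bigoplus_{i\in\mathbb Z}\mathbb Q h_i$; $\Lambda_i\in\mathfrak h^*$ with $\Lambda_i(h_j)=\delta_{ij}$; $\alpha_i=2\Lambda_i-\Lambda_{i-1}-\Lambda_{i+1}$; $P=\bigoplus_i\mathbb Z\Lambda_i$. The algebra $\mathcal U_q(\hat{sl}_\infty)$ is the $\mathbb C$-algebra generated by $x_{i,r}^{\pm}$ ($i,r\in\mathbb Z$), $k_h$ ($h\in\mathfrak h$), $h_{i,m}$ ($i\in\mathbb Z$, $m\in\mathbb Z\setminus\{0\}$). With $x_i^\pm(z)=\sum_{r}x_{i,r}^\pm z^r$, $\phi_i^\pm(z)=\sum_{m\ge0}\phi^\pm_{i,\pm m}z^{\pm m}=k_{\pm h_i}\exp(\pm(q-q^{-1})\sum_{m\ge1}h_{i,\pm m}z^{\pm m})$, $\delta(z)=\sum_{s\in\mathbb Z}z^s$, the relations are: $k_hk_{h'}=k_{h+h'}$,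 $k_0=1$; all $k_h$ and all coefficients of the $\phi_i^\pm(z)$ commute; $k_hx_j^\pm(z)k_{-h}=q^{\pm\alpha_j(h)}x_j^\pm(z)$; for $\epsilon\in\{+,-\}$, $(w-q^{\pm C_{ij}}z)\phi_i^{\epsilon}(z)x_j^\pm(w)=(q^{\pm C_{ij}}w-z)x_j^\pm(w)\phi_i^{\epsilon}(z)$; $[x_i^+(z),x_j^-(w)]=\frac{\delta_{ij}}{q-q^{-1}}\big(\delta(w/z)\phi_i^+(w)-\delta(z/w)\phi_i^-(z)\big)$; $(w-q^{\pm C_{ij}}z)x_i^\pm(z)x_j^\pm(w)=(q^{\pm C_{ij}}w-z)x_j^\pm(w)x_i^\pm(z)$; for $|i-j|=1$, $x_i^\pm(z_1)x_i^\pm(z_2)x_j^\pm(w)-(q+q^{-1})x_i^\pm(z_1)x_j^\pm(w)x_i^\pm(z_2)+x_j^\pm(w)x_i^\pm(z_1)x_i^\pm(z_2)+(z_1\leftrightarrow z_2)=0$; and $[x_i^\pm(z),x_j^\pm(w)]=0$ for $|i-j|\ge2$. $\mathcal U_q^h(\hat{sl}_\infty)$ is the subalgebra generated by all $x_{i,0}^\pm$ and $k_h$. For a finite interval $J=[c,d]\subset\mathbb Z$, $\mathcal U_q(\hat{sl}_\infty)_J$ is the subalgebra generated by $x_{i,r}^\pm$, $h_{i,m}$ ($i\in J$) and $k_h$ ($h\in\bigoplus_{j\in J}\mathbb Qh_j$). The module. Put $\psi(z)=\frac{q-q^{-1}z}{1-z}$. Let $\mathcal T_{[1,\ell]}$ be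 the set of integer sequences $T=(i_1<\cdots<i_\ell)$. $\tilde e_iT$ is obtained by replacing the entry $i+1$ by $i$ ($0$ if $i+1\notin T$ or $i\in T$), $\tilde f_iT$ by replacing $i$ by $i+1$ ($0$ if $i\notin T$ or $i+1\in T$). $V(Y_{\ell,a}Y_{0,aq^\ell}^{-1})$ is the $\mathcal U_q(\hat{sl}_\infty)$-module (constructed in the paper as a submodule of the fusion product of the fundamental modules $V(Y_{\ell,a})$ and $V(Y_{0,aq^\ell}^{-1})$) with basis $\{T_a\}_{T\in\mathcal T_{[1,\ell]}}$ and action ($0_a=0$; rational functions expanded in $z^{\pm1}$ for $\phi_i^\pm$): $x_i^+(z)T_a=\sum_{p}\delta_{\{i_p=i+1\}}\delta(aq^{i+\ell+1-2p}z)(\tilde e_iT)_a$; $x_i^-(z)T_a=\sum_{p}\delta_{\{i_p=i\}}\delta(aq^{i+\ell+1-2p}z)(\tilde f_iT)_a$; $\phi_i^\pm(z)T_a=\psi(aq^{i+\ell+3-2p}z)^{-1}T_a$ if $i_p=i+1$ for some $p$ and $i\notin T$; $=\psi(aq^{i+\ell+1-2p}z)T_a$ if $i_p=i$ for some $p$ and $i+1\notin T$; $=T_a$ otherwise. Definitions. A module $V$ is integrable if $V=\bigoplus_{\nu\in P}V_\nu$, $V_\nu=\{v:k_{h_i}v=q^{\nu(h_i)}v\ \forall i\}$, and all $x_{i,0}^\pm$ are locally nilpotent. For a monomial $m=\prod Y_{i,b}^{u_{i,b}}$ (finite product, $i\in\mathbb Z,b\in\mathbb C^*$), $V_m$ is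 the simultaneous generalized eigenspace on which $\phi_i^\pm(z)$ has generalized eigenvalue the expansion in $z^{\pm1}$ of $\prod_b\psi(bqz)^{u_{i,b}}$ for every $i$; its nonzero vectors are said to have $\ell$-weight $m$. For an integrable module and $v\in V_\lambda$, $v$ is $i$-extremal if $x_{i,0}^+v=0$ (then $\lambda(h_i)\ge0$ when $v\neq0$, and $S_i(v)=(x_{i,0}^-)^{(\lambda(h_i))}v$) or $x_{i,0}^-v=0$ (then $S_i(v)=(x_{i,0}^+)^{(-\lambda(h_i))}v$), where $x^{(r)}=x^r/[r]_q!$; $v$ is extremal (for $\mathcal U_q^h(\hat{sl}_\infty)$) if $v$ and all $S_{i_1}\cdots S_{i_l}(v)$ are $i$-extremal for all $i,i_1,\dots,i_l\in\mathbb Z$. An extremal loop weight module of $\ell$-weight $m$ is an integrable module $V$ having a vector $v\in V_m$ such that (i) $\mathcal U_q(\hat{sl}_\infty)v=V$; (ii) $v$ is extremal for $\mathcal U_q^h(\hat{sl}_\infty)$; (iii) $\mathcal U_q(\hat{sl}_\infty)_J\,w$ is finite-dimensional for all $w\in V$ and all finite intervals $J\subset\mathbb Z$. The claim asserts this with $m=Y_{\ell,a}Y_{0,aq^\ell}^{-1}$ and $v=(1<2<\cdots<\ell)_a$. *)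

theory Defs
  imports
    Complex_Main
    "HOL-Library.Poly_Mapping"
    "HOL-Computational_Algebra.Formal_Power_Series"
begin

section \<open>Free associative algebras\<close>

datatype 'g fword = FWord "'g list"

instantiation fword :: (type) monoid_add
begin

definition zero_fword :: "'a fword" where
  "0 = FWord []"

fun plus_fword :: "'a fword \<Rightarrow> 'a fword \<Rightarrow> 'a fword" where
  "FWord u + FWord v = FWord (u @ v)"

instance
proof
  fix u v w :: "'a fword"
  show "u + v + w = u + (v + w)" by (cases u; cases v; cases w) simp
  show "0 + u = u" by (cases u) (simp add: zero_fword_def)
  show "u + 0 = u" by (cases u) (simp add: zero_fword_def)
qed

end

text \<open>The monoid algebra of the monoid of words, i.e. the free algebra; its product is the
  convolution product of \<^theory>\<open>HOL-Library.Poly_Mapping\<close>.\<close>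

type_synonym 'g free_algebra = "'g fword \<Rightarrow>\<^sub>0 complex"

definition scal :: "complex \<Rightarrow> 'g free_algebra" where
  "scal c = Poly_Mapping.single 0 c"

definition gen :: "'g \<Rightarrow> 'g free_algebra" where
  "gen g = Poly_Mapping.single (FWord [g]) 1"

inductive_set subalgebra_gen :: "'g free_algebra set \<Rightarrow> 'g free_algebra set"
  for S :: "'g free_algebra set" where
  "u \<in> S \<Longrightarrow> u \<in> subalgebra_gen S"
| "scal c \<in> subalgebra_gen S"
| "u \<in> subalgebra_gen S \<Longrightarrow> v \<in> subalgebra_gen S \<Longrightarrow> u + v \<in> subalgebra_gen S"
| "u \<in> subalgebra_gen S \<Longrightarrow> v \<in> subalgebra_gen S \<Longrightarrow> u * v \<in> subalgebra_gen S"


section \<open>Cartan data of type \<open>sl\<^sub>\<infinity>\<close>\<close>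

definition cartan_mat :: "int \<Rightarrow> int \<Rightarrow> int" where
  "cartan_mat i j = (if i = j then 2 else if \<bar>i - j\<bar> = 1 then - 1 else 0)"

text \<open>\<open>\<hh> = \<Oplus>\<^sub>i \<rat> h\<^sub>i\<close>, an element being its finitely supported family of coordinates;
  the coordinate functionals are the \<open>\<Lambda>\<^sub>i\<close>. Likewise \<open>\<nu> = \<Sum>\<^sub>i \<nu>\<^sub>i \<Lambda>\<^sub>i \<in> P\<close> is the family of the
  integers \<open>\<nu>\<^sub>i = \<nu>(h\<^sub>i)\<close>.\<close>

type_synonym cartan = "int \<Rightarrow>\<^sub>0 rat"
type_synonym weight = "int \<Rightarrow>\<^sub>0 int"

definition coroot :: "int \<Rightarrow> cartan" where
  "coroot i = Poly_Mapping.single i 1"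

definition Lam :: "int \<Rightarrow> cartan \<Rightarrow> rat" where
  "Lam i h = Poly_Mapping.lookup h i"

definition alpha :: "int \<Rightarrow> cartan \<Rightarrow> rat" where
  "alpha i h = 2 * Lam i h - Lam (i - 1) h - Lam (i + 1) h"


section \<open>The quantum affinization of \<open>U\<^sub>q(sl\<^sub>\<infinity>)\<close> by generators and relations\<close>

datatype pm = Plus | Minus

fun sg :: "pm \<Rightarrow> int" where
  "sg Plus = 1"
| "sg Minus = - 1"

fun opp :: "pm \<Rightarrow> pm" where
  "opp Plus = Minus"
| "opp Minus = Plus"

datatype uq_gen = GX pm int int | GK cartan | GH int int

type_synonym uq_free = "uq_gen free_algebra"

definition gx :: "pm \<Rightarrow> int \<Rightarrow> int \<Rightarrow> uq_free" where
  "gx s i r = gen (GX s i r)"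

definition gk :: "cartan \<Rightarrow> uq_free" where
  "gk h = gen (GK h)"

definition gh :: "int \<Rightarrow> int \<Rightarrow> uq_free" where
  "gh i m = gen (GH i m)"

definition qpow :: "complex \<Rightarrow> rat \<Rightarrow> complex" where
  "qpow t r = exp (t * of_rat r)"

text \<open>\<open>phi t s i\<close> is the series \<open>\<phi>\<^sub>i\<^sup>s\<close> as a power series in \<open>z\<close> for \<open>s = Plus\<close> and in \<open>z\<inverse>\<close> for
  \<open>s = Minus\<close>; the exponential is the substitution of the argument into \<open>\<Sum>\<^sub>n Z\<^sup>n / n!\<close>.\<close>

definition phi :: "complex \<Rightarrow> pm \<Rightarrow> int \<Rightarrow> uq_free fps" where
  "phi t s i =
     fps_const (gk (if s = Plus then coroot i else - coroot i)) *
     (Abs_fps (\<lambda>n. scal (1 / fact n)) oo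
       (fps_const (scal (of_int (sg s) * (exp t - inverse (exp t)))) *
        Abs_fps (\<lambda>m. if m = 0 then 0 else gh i (sg s * int m))))"

text \<open>The coefficient of \<open>z\<^sup>m\<close> in \<open>\<phi>\<^sub>i\<^sup>s(z)\<close> for an arbitrary integer \<open>m\<close>.\<close>

definition phi_coeff :: "complex \<Rightarrow> pm \<Rightarrow> int \<Rightarrow> int \<Rightarrow> uq_free" where
  "phi_coeff t s i m = (if 0 \<le> sg s * m then fps_nth (phi t s i) (nat (sg s * m)) else 0)"

definition commutator :: "'r::ring \<Rightarrow> 'r \<Rightarrow> 'r" where
  "commutator u v = u * v - v * u"

definition serre :: "complex \<Rightarrow> pm \<Rightarrow> int \<Rightarrow> int \<Rightarrow> int \<Rightarrow> int \<Rightarrow> int \<Rightarrow> uq_free" where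
  "serre t s i j m n r =
     gx s i m * gx s i n * gx s j r
     - scal (exp t + inverse (exp t)) * gx s i m * gx s j r * gx s i n
     + gx s j r * gx s i m * gx s i n"

text \<open>The relations between the currents are written coefficientwise: the relators below are the
  coefficients of \<open>z\<^sup>m w\<^sup>r\<close> (in the Serre relations, of \<open>z\<^sub>1\<^sup>m z\<^sub>2\<^sup>n w\<^sup>r\<close>). The first relator discards the
  letter \<open>GH i 0\<close>, since there is no generator \<open>h\<^bsub>i,0\<^esub>\<close>.\<close>

inductive_set uq_relators :: "complex \<Rightarrow> uq_free set" for t :: complex where
  h_zero: "gh i 0 \<in> uq_relators t"
| k_add: "gk h * gk h' - gk (h + h') \<in> uq_relators t"
| k_zero: "gk 0 - 1 \<in> uq_relators t"
| k_k: "commutator (gk h) (gk h') \<in> uq_relators t"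
| k_phi: "commutator (gk h) (phi_coeff t s i m) \<in> uq_relators t"
| phi_phi: "commutator (phi_coeff t s i m) (phi_coeff t s' j n) \<in> uq_relators t"
| k_x: "gk h * gx s j r * gk (- h) - scal (qpow t (of_int (sg s) * alpha j h)) * gx s j r
        \<in> uq_relators t"
| phi_x: "c = exp t powi (sg s * cartan_mat i j) \<Longrightarrow>
        (phi_coeff t e i m * gx s j (r - 1) - scal c * phi_coeff t e i (m - 1) * gx s j r)
        - (scal c * gx s j (r - 1) * phi_coeff t e i m - gx s j r * phi_coeff t e i (m - 1))
        \<in> uq_relators t"
| xp_xm: "commutator (gx Plus i m) (gx Minus j r)
        - (if i = j
           then scal (1 / (exp t - inverse (exp t)))
                * (phi_coeff t Plus i (m + r) - phi_coeff t Minus i (m + r))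
           else 0)
        \<in> uq_relators t"
| x_x: "c = exp t powi (sg s * cartan_mat i j) \<Longrightarrow>
        (gx s i m * gx s j (r - 1) - scal c * gx s i (m - 1) * gx s j r)
        - (scal c * gx s j (r - 1) * gx s i m - gx s j r * gx s i (m - 1))
        \<in> uq_relators t"
| serre_adjacent: "\<bar>i - j\<bar> = 1 \<Longrightarrow>
        serre t s i j m n r + serre t s i j n m r \<in> uq_relators t"
| x_x_far: "\<bar>i - j\<bar> \<ge> 2 \<Longrightarrow> commutator (gx s i m) (gx s j r) \<in> uq_relators t"

text \<open>The (preimage in the free algebra of the) subalgebra attached to a set of nodes.\<close>

definition uq_sub :: "int set \<Rightarrow> uq_free set" where
  "uq_sub J = subalgebra_gen
     ({gx s i r | s i r. i \<in> J} \<union> {gh i m | i m. i \<in> J \<and> m \<noteq> 0} \<union>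
      {gk h | h. Poly_Mapping.keys h \<subseteq> J})"

text \<open>A module over the algebra presented by the relators is a module over the free algebra that is
  annihilated by the relators.\<close>

definition uq_module ::
  "complex \<Rightarrow> (complex \<Rightarrow> 'v::ab_group_add \<Rightarrow> 'v) \<Rightarrow> (uq_free \<Rightarrow> 'v \<Rightarrow> 'v) \<Rightarrow> bool" where
  "uq_module t scale act \<longleftrightarrow>
     vector_space scale \<and>
     (\<forall>u. Vector_Spaces.linear scale scale (act u)) \<and>
     (\<forall>c v. act (scal c) v = scale c v) \<and>
     (\<forall>u u' v. act (u + u') v = act u v + act u' v) \<and>
     (\<forall>u u' v. act (u * u') v = act u (act u' v)) \<and>
     (\<forall>u\<in>uq_relators t. \<forall>v. act u v = 0)"


section \<open>Integrable modules and \<open>\<ell>\<close>-weights\<close>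

definition weight_space ::
  "complex \<Rightarrow> (complex \<Rightarrow> 'v::ab_group_add \<Rightarrow> 'v) \<Rightarrow> (uq_free \<Rightarrow> 'v \<Rightarrow> 'v) \<Rightarrow> weight \<Rightarrow> 'v set" where
  "weight_space t scale act \<nu> =
     {v. \<forall>i. act (gk (coroot i)) v = scale (exp t powi Poly_Mapping.lookup \<nu> i) v}"

definition integrable_module ::
  "complex \<Rightarrow> (complex \<Rightarrow> 'v::ab_group_add \<Rightarrow> 'v) \<Rightarrow> (uq_free \<Rightarrow> 'v \<Rightarrow> 'v) \<Rightarrow> bool" where
  "integrable_module t scale act \<longleftrightarrow>
     uq_module t scale act \<and>
     (\<forall>v. \<exists>!d :: weight \<Rightarrow>\<^sub>0 'v.
        (\<forall>\<nu>. Poly_Mapping.lookup d \<nu> \<in> weight_space t scale act \<nu>) \<and>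
        v = (\<Sum>\<nu>\<in>Poly_Mapping.keys d. Poly_Mapping.lookup d \<nu>)) \<and>
     (\<forall>s i v. \<exists>n. (act (gx s i 0) ^^ n) v = 0)"

text \<open>The expansion of \<open>\<psi>(bz) = (q - q\<inverse>bz) / (1 - bz)\<close> in \<open>z\<close> and in \<open>y = z\<inverse>\<close>; in the latter case
  \<open>\<psi>(b/y) = (qy - q\<inverse>b) / (y - b)\<close>.\<close>

fun psi :: "complex \<Rightarrow> pm \<Rightarrow> complex \<Rightarrow> complex fps" where
  "psi t Plus b =
     (fps_const (exp t) - fps_const (inverse (exp t) * b) * fps_X) / (1 - fps_const b * fps_X)"
| "psi t Minus b =
     (fps_const (exp t) * fps_X - fps_const (inverse (exp t) * b)) / (fps_X - fps_const b)"

text \<open>Monomials in the \<open>Y\<^bsub>i,b\<^esub>\<^sup>\<plusminus>\<^sup>1\<close> are given by their exponents, so multiplication of monomials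
  is addition here.\<close>

type_synonym l_weight = "(int \<times> complex) \<Rightarrow>\<^sub>0 int"

definition Ymon :: "int \<Rightarrow> complex \<Rightarrow> l_weight" where
  "Ymon i b = Poly_Mapping.single (i, b) 1"

definition is_monomial :: "l_weight \<Rightarrow> bool" where
  "is_monomial m \<longleftrightarrow> (\<forall>i. (i, 0) \<notin> Poly_Mapping.keys m)"

definition l_weight_series :: "complex \<Rightarrow> l_weight \<Rightarrow> pm \<Rightarrow> int \<Rightarrow> complex fps" where
  "l_weight_series t m s i =
     (\<Prod>b\<in>{b. (i, b) \<in> Poly_Mapping.keys m}.
        psi t s (b * exp t) powi Poly_Mapping.lookup m (i, b))"

definition l_weight_space ::
  "complex \<Rightarrow> (complex \<Rightarrow> 'v::ab_group_add \<Rightarrow> 'v) \<Rightarrow> (uq_free \<Rightarrow> 'v \<Rightarrow> 'v) \<Rightarrow> l_weight \<Rightarrow> 'v set" where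
  "l_weight_space t scale act m =
     {v. \<forall>s i n. \<exists>N.
        ((\<lambda>u. act (fps_nth (phi t s i) n) u
              - scale (fps_nth (l_weight_series t m s i) n) u) ^^ N) v = 0}"


section \<open>Extremal vectors and extremal loop weight modules\<close>

definition qint :: "complex \<Rightarrow> nat \<Rightarrow> complex" where
  "qint t n = (exp t ^ n - inverse (exp t) ^ n) / (exp t - inverse (exp t))"

definition qfact :: "complex \<Rightarrow> nat \<Rightarrow> complex" where
  "qfact t n = (\<Prod>k=1..n. qint t k)"

definition divpow :: "complex \<Rightarrow> uq_free \<Rightarrow> nat \<Rightarrow> uq_free" where
  "divpow t u n = scal (1 / qfact t n) * u ^ n"

definition i_extremal ::
  "complex \<Rightarrow> (complex \<Rightarrow> 'v::ab_group_add \<Rightarrow> 'v) \<Rightarrow> (uq_free \<Rightarrow> 'v \<Rightarrow> 'v) \<Rightarrow> int \<Rightarrow> 'v \<Rightarrow> bool" where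
  "i_extremal t scale act i v \<longleftrightarrow>
     (\<exists>\<nu>. v \<in> weight_space t scale act \<nu>) \<and> (\<exists>s. act (gx s i 0) v = 0)"

text \<open>All vectors obtained from \<open>v\<close> by iterating the operations \<open>S\<^sub>i\<close>. If \<open>u \<noteq> 0\<close> then \<open>\<nu>\<close> is determined by \<open>u\<close>
  and, in an integrable module, \<open>nat\<close> does not truncate in the step rule; both alternatives for
  \<open>s\<close> give \<open>u\<close> itself when both apply.\<close>

inductive_set extremal_orbit ::
  "complex \<Rightarrow> (complex \<Rightarrow> 'v::ab_group_add \<Rightarrow> 'v) \<Rightarrow> (uq_free \<Rightarrow> 'v \<Rightarrow> 'v) \<Rightarrow> 'v \<Rightarrow> 'v set"
  for t scale act v where
  start: "v \<in> extremal_orbit t scale act v"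
| step: "\<lbrakk>u \<in> extremal_orbit t scale act v; u \<in> weight_space t scale act \<nu>;
          act (gx s i 0) u = 0\<rbrakk> \<Longrightarrow>
        act (divpow t (gx (opp s) i 0) (nat (sg s * Poly_Mapping.lookup \<nu> i))) u
          \<in> extremal_orbit t scale act v"

definition extremal ::
  "complex \<Rightarrow> (complex \<Rightarrow> 'v::ab_group_add \<Rightarrow> 'v) \<Rightarrow> (uq_free \<Rightarrow> 'v \<Rightarrow> 'v) \<Rightarrow> 'v \<Rightarrow> bool" where
  "extremal t scale act v \<longleftrightarrow>
     (\<forall>u\<in>extremal_orbit t scale act v. \<forall>i. i_extremal t scale act i u)"

definition finite_dimensional :: "(complex \<Rightarrow> 'v::ab_group_add \<Rightarrow> 'v) \<Rightarrow> 'v set \<Rightarrow> bool" where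
  "finite_dimensional scale W \<longleftrightarrow> (\<exists>B. finite B \<and> W = module.span scale B)"

definition elw_generator ::
  "complex \<Rightarrow> (complex \<Rightarrow> 'v::ab_group_add \<Rightarrow> 'v) \<Rightarrow> (uq_free \<Rightarrow> 'v \<Rightarrow> 'v) \<Rightarrow> l_weight \<Rightarrow> 'v \<Rightarrow> bool" where
  "elw_generator t scale act m v \<longleftrightarrow>
     v \<in> l_weight_space t scale act m \<and>
     {act u v | u. True} = UNIV \<and>
     extremal t scale act v \<and>
     (\<forall>w c d. finite_dimensional scale {act u w | u. u \<in> uq_sub {c..d}})"

definition extremal_loop_weight_module ::
  "complex \<Rightarrow> (complex \<Rightarrow> 'v::ab_group_add \<Rightarrow> 'v) \<Rightarrow> (uq_free \<Rightarrow> 'v \<Rightarrow> 'v) \<Rightarrow> l_weight \<Rightarrow> bool" where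
  "extremal_loop_weight_module t scale act m \<longleftrightarrow>
     is_monomial m \<and> integrable_module t scale act \<and> (\<exists>v. elw_generator t scale act m v)"


section \<open>The module \<open>V(Y\<^bsub>l,a\<^esub> Y\<^bsub>0,aq^l\<^esub>\<inverse>)\<close>\<close>

definition tableaux :: "nat \<Rightarrow> int list set" where
  "tableaux l = {T. length T = l \<and> sorted_wrt (<) T}"

text \<open>\<open>entry T p\<close> is \<open>i\<^sub>p\<close> for \<open>T = (i\<^sub>1 < \<dots> < i\<^sub>l)\<close>, with \<open>p\<close> counted from 1.\<close>

definition entry :: "int list \<Rightarrow> nat \<Rightarrow> int" where
  "entry T p = T ! (p - 1)"

definition replace_entry :: "int \<Rightarrow> int \<Rightarrow> int list \<Rightarrow> int list option" where
  "replace_entry i j T =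
     (if i \<in> set T \<and> j \<notin> set T then Some (map (\<lambda>k. if k = i then j else k) T) else None)"

text \<open>The crystal operators, \<open>None\<close> playing the role of 0.\<close>

definition te :: "int \<Rightarrow> int list \<Rightarrow> int list option" where
  "te i T = replace_entry (i + 1) i T"

definition tf :: "int \<Rightarrow> int list \<Rightarrow> int list option" where
  "tf i T = replace_entry i (i + 1) T"

definition vec_of :: "(int list \<Rightarrow> 'v::zero) \<Rightarrow> int list option \<Rightarrow> 'v" where
  "vec_of b T = (case T of None \<Rightarrow> 0 | Some T' \<Rightarrow> b T')"

definition tableau_basis ::
  "(complex \<Rightarrow> 'v::ab_group_add \<Rightarrow> 'v) \<Rightarrow> nat \<Rightarrow> (int list \<Rightarrow> 'v) \<Rightarrow> bool" where
  "tableau_basis scale l b \<longleftrightarrow>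
     inj_on b (tableaux l) \<and>
     \<not> module.dependent scale (b ` tableaux l) \<and>
     module.span scale (b ` tableaux l) = UNIV"

text \<open>\<open>b T\<close> is the basis vector \<open>T\<^sub>a\<close>. The formulas for \<open>x\<^sub>i\<^sup>\<plusminus>(z)\<close> are those for the coefficients of
  \<open>z\<^sup>r\<close>, with \<open>\<delta>(cz) = \<Sum>\<^sub>r c\<^sup>r z\<^sup>r\<close>.\<close>

definition is_V_module ::
  "complex \<Rightarrow> nat \<Rightarrow> complex \<Rightarrow> (complex \<Rightarrow> 'v::ab_group_add \<Rightarrow> 'v) \<Rightarrow> (int list \<Rightarrow> 'v) \<Rightarrow>
   (uq_free \<Rightarrow> 'v \<Rightarrow> 'v) \<Rightarrow> bool" where
  "is_V_module t l a scale b act \<longleftrightarrow>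
     uq_module t scale act \<and>
     (\<forall>T\<in>tableaux l. \<forall>i r.
        act (gx Plus i r) (b T) =
          (\<Sum>p=1..l. if entry T p = i + 1
             then scale ((a * exp t powi (i + int l + 1 - 2 * int p)) powi r) (vec_of b (te i T))
             else 0)) \<and>
     (\<forall>T\<in>tableaux l. \<forall>i r.
        act (gx Minus i r) (b T) =
          (\<Sum>p=1..l. if entry T p = i
             then scale ((a * exp t powi (i + int l + 1 - 2 * int p)) powi r) (vec_of b (tf i T))
             else 0)) \<and>
     (\<forall>T\<in>tableaux l. \<forall>s i n.
        (\<forall>p\<in>{1..l}. entry T p = i + 1 \<and> i \<notin> set T \<longrightarrow>
           act (fps_nth (phi t s i) n) (b T) =
             scale (fps_nth (inverse (psi t s (a * exp t powi (i + int l + 3 - 2 * int p)))) n) (b T)) \<and>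
        (\<forall>p\<in>{1..l}. entry T p = i \<and> i + 1 \<notin> set T \<longrightarrow>
           act (fps_nth (phi t s i) n) (b T) =
             scale (fps_nth (psi t s (a * exp t powi (i + int l + 1 - 2 * int p))) n) (b T)) \<and>
        ((i \<in> set T \<longleftrightarrow> i + 1 \<in> set T) \<longrightarrow>
           act (fps_nth (phi t s i) n) (b T) = scale (fps_nth 1 n) (b T)))"

end

(*
  In the basis indexed by finite sets A of integers with l elements, each current acts by moving one
  entry, x_i^+(z) from i+1 to i and x_i^-(z) from i to i+1, with a single pole. Its position is
  a q^(i+l-1-2N), where N is the number of entries of A below i, whichever of the two operators is
  applied. The series phi_i acts by (q^w - q^(-w) g z) / (1 - g z), where w = [i in A] - [i+1 in A]
  and g is that same parameter, so every relation becomes an identity in q and g; the h_(i,m) are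
  read off a logarithm of this series.

  The weights w determine A. Hence k_h and h_(i,m) act diagonally in every module with these
  formulas, weight spaces are at most one-dimensional, and all claims reduce to moving entries: the
  operators S_i permute the basis lines, entries outside [c, d+1] are fixed by the subalgebra of
  [c, d], and any two sets are connected by moves, which are inverted by the opposite operator.
*)
theory Submission
  imports Defs
begin

subsection \<open>Representations of free algebras\<close>

text \<open>The formulas that define the module prescribe the currents x and the series phi_i, but
  neither k_h for a general rational h nor the h_(i,m). Existence and the claim about an arbitrary
  action meet this gap from opposite sides. For existence, eigenvalues are chosen: k_h acts on the
  line of A by q^(lambda(h)), where lambda is the weight of A. For an arbitrary action, diagonality
  is not given but forced. Every k_h commutes with all k_(h_i) and so preserves their common
  eigenspaces; these are lines because q is not a root of unity. The h_(i,m) are diagonal because an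
  exponential series determines its argument degree by degree. Finite-dimensionality uses only that
  the lines are preserved, never the eigenvalues themselves. Passing from lists to sets turns the
  position p of an entry into a count of smaller entries. Each relation is then compared through two
  integers per node, the weight and this count, whose changes under a move are explicit.\<close>

locale free_algebra_module = vector_space scale
  for scale :: "complex \<Rightarrow> 'v::ab_group_add \<Rightarrow> 'v" +
  fixes act :: "'g free_algebra \<Rightarrow> 'v \<Rightarrow> 'v"
  assumes linear_act: "Vector_Spaces.linear scale scale (act u)"
    and act_scal [simp]: "act (scal c) v = scale c v"
    and act_add: "act (u + u') v = act u v + act u' v"
    and act_mult: "act (u * u') v = act u (act u' v)"
begin

sublocale act: Vector_Spaces.linear scale scale "act u" for u
  by (rule linear_act)

lemma act_0 [simp]: "act 0 v = 0"
  using act_scal[of 0 v] by (simp add: scal_def)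

lemma act_1 [simp]: "act 1 v = v"
  using act_scal[of 1 v] by (simp add: scal_def)

lemma act_diff: "act (u - u') v = act u v - act u' v"
  using act_add[of "u - u'" u' v] by simp

lemma act_sum: "act (\<Sum>x\<in>A. f x) v = (\<Sum>x\<in>A. act (f x) v)"
  by (induction A rule: infinite_finite_induct) (auto simp: act_add)

lemma act_commutator: "act (commutator u u') v = act u (act u' v) - act u' (act u v)"
  by (simp add: commutator_def act_diff act_mult)

lemma act_power: "act (u ^ n) v = (act u ^^ n) v"
  by (induction n) (auto simp: act_mult)

lemma act_scal_mult: "act (scal c * u) v = scale c (act u v)"
  by (simp add: act_mult)

text \<open>Stability under products and compositions turns the formula that defines
  \<open>phi\<close> into the same formula for scalar series, although the free algebra is not
  commutative.\<close>

definition eigen_series :: "'g free_algebra fps \<Rightarrow> complex fps \<Rightarrow> 'v \<Rightarrow> bool" where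
  "eigen_series F f v \<longleftrightarrow> (\<forall>n. act (fps_nth F n) v = scale (fps_nth f n) v)"

lemma eigen_series_mult:
  "eigen_series F f v \<Longrightarrow> eigen_series G g v \<Longrightarrow> eigen_series (F * G) (f * g) v"
  by (simp add: eigen_series_def fps_mult_nth act_sum act_mult act.scale scale_sum_left mult.commute)

lemma eigen_series_const: "act u v = scale c v \<Longrightarrow> eigen_series (fps_const u) (fps_const c) v"
  by (simp add: eigen_series_def)

lemma eigen_series_power: "eigen_series F f v \<Longrightarrow> eigen_series (F ^ n) (f ^ n) v"
proof (induction n)
  case 0
  then show ?case by (simp add: eigen_series_def)
qed (simp add: eigen_series_mult)

lemma eigen_series_compose:
  assumes "eigen_series F f v" "eigen_series G g v"
  shows "eigen_series (F oo G) (f oo g) v"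
  using assms(1) eigen_series_power[OF assms(2)]
  by (simp add: eigen_series_def fps_compose_nth act_sum act_mult act.scale scale_sum_left mult.commute)

lemma eigen_series_Abs_fps:
  "(\<And>n. act (F n) v = scale (f n) v) \<Longrightarrow> eigen_series (Abs_fps F) (Abs_fps f) v"
  by (simp add: eigen_series_def)

text \<open>The elements of the free algebra that have \<open>v\<close> as an eigenvector. The
  eigenvalue is left existential, since for \<open>gk h\<close> and \<open>gh i m\<close> in a given
  module its existence is all that the later arguments ask for.\<close>

definition stable_line :: "'v \<Rightarrow> 'g free_algebra set" where
  "stable_line v = {u. \<exists>c. act u v = scale c v}"

lemma stable_line_scal: "scal c \<in> stable_line v"
  by (auto simp: stable_line_def)

lemma stable_line_0: "0 \<in> stable_line v"
  by (auto simp: stable_line_def intro: exI[of _ 0])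

lemma stable_line_1: "1 \<in> stable_line v"
  by (auto simp: stable_line_def intro: exI[of _ 1])

lemma stable_line_mult:
  assumes "u \<in> stable_line v" "u' \<in> stable_line v" shows "u * u' \<in> stable_line v"
proof -
  obtain c c' where "act u v = scale c v" "act u' v = scale c' v"
    using assms by (auto simp: stable_line_def)
  then have "act (u * u') v = scale (c' * c) v" by (simp add: act_mult act.scale)
  then show ?thesis by (auto simp: stable_line_def)
qed

lemma stable_line_add:
  assumes "u \<in> stable_line v" "u' \<in> stable_line v" shows "u + u' \<in> stable_line v"
  using assms by (auto simp: stable_line_def act_add scale_left_distrib[symmetric])

lemma stable_line_sum: "(\<And>x. x \<in> A \<Longrightarrow> f x \<in> stable_line v) \<Longrightarrow> (\<Sum>x\<in>A. f x) \<in> stable_line v"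
  by (induction A rule: infinite_finite_induct) (auto simp: stable_line_add stable_line_0)

lemma stable_line_diff:
  assumes "u + u' \<in> stable_line v" "u' \<in> stable_line v" shows "u \<in> stable_line v"
proof -
  obtain c c' where "act (u + u') v = scale c v" "act u' v = scale c' v"
    using assms by (auto simp: stable_line_def)
  then have "act u v = scale (c - c') v"
    by (simp add: act_add scale_left_diff_distrib algebra_simps)
  then show ?thesis by (auto simp: stable_line_def)
qed

lemma stable_line_scal_mult:
  assumes "scal c * u \<in> stable_line v" "c \<noteq> 0" shows "u \<in> stable_line v"
proof -
  obtain d where "scale c (act u v) = scale d v"
    using assms by (auto simp: stable_line_def act_mult)
  then have "scale (1 / c) (scale c (act u v)) = scale (1 / c) (scale d v)" by simp
  then show ?thesis using assms(2) by (auto simp: stable_line_def)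
qed

text \<open>Since G has no constant term, the coefficient of degree n in a power with exponent at
  least 2 involves only coefficients of G of degree below n. For exponent 1 it is the unknown
  coefficient itself.\<close>

lemma stable_line_power_nth:
  assumes "fps_nth G 0 = 0" "\<And>j. j < n \<Longrightarrow> fps_nth G j \<in> stable_line v" "i \<noteq> 1"
  shows "fps_nth (G ^ i) n \<in> stable_line v"
proof -
  have *: "fps_nth (G ^ i) k \<in> stable_line v" if "k < n" for i k
    using that
  proof (induction i arbitrary: k)
    case (Suc i)
    then show ?case
      by (auto simp: fps_mult_nth intro!: stable_line_sum stable_line_mult assms(2))
  qed (auto simp: stable_line_0 stable_line_1)
  show ?thesis
  proof (cases i)
    case (Suc i')
    have "fps_nth G j * fps_nth (G ^ i') (n - j) \<in> stable_line v" if jn: "j \<le> n" for j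
    proof -
      consider "j = 0" | "j = n" | "0 < j" "j < n" using jn by linarith
      then show ?thesis
      proof cases
        case 2
        \<comment> \<open>The only term containing the unknown coefficient of degree n is multiplied
          by this constant term, and i' is at least 1.\<close>
        have "fps_nth (G ^ i') 0 = 0"
          using assms Suc by (cases i') (auto simp: fps_mult_nth)
        with 2 show ?thesis by (simp add: stable_line_0)
      qed (auto simp: assms stable_line_0 intro!: stable_line_mult *)
    qed
    then show ?thesis
      using Suc by (auto simp: fps_mult_nth intro!: stable_line_sum)
  qed (auto simp: stable_line_0 stable_line_1)
qed

text \<open>In degree \<open>n\<close> the argument of a composition occurs only in the linear term together with its
  lower coefficients, so its coefficients can be recovered recursively.\<close>

lemma stable_line_of_compose:
  assumes F: "\<And>n. fps_nth F n \<in> stable_line v"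
    and FG: "\<And>n. fps_nth (F oo G) n \<in> stable_line v"
    and G: "fps_nth G 0 = 0" and F1: "fps_nth F 1 = 1"
  shows "fps_nth G n \<in> stable_line v"
proof (induction n rule: less_induct)
  case (less n)
  show ?case
  proof (cases "n = 0")
    case False
    have "fps_nth (F oo G) n =
        fps_nth G n + (\<Sum>i\<in>{0..n} - {1}. fps_nth F i * fps_nth (G ^ i) n)"
      using False F1 by (subst fps_compose_nth, subst sum.remove[of _ 1]) auto
    moreover have "(\<Sum>i\<in>{0..n} - {1}. fps_nth F i * fps_nth (G ^ i) n) \<in> stable_line v"
      by (auto intro!: stable_line_sum stable_line_mult F stable_line_power_nth G less)
    ultimately show ?thesis
      using FG[of n] by (auto intro: stable_line_diff)
  qed (simp add: G stable_line_0)
qed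

end

section \<open>Extending operators from the generators to the free algebra\<close>

fun word_action :: "('g \<Rightarrow> 'v \<Rightarrow> 'v) \<Rightarrow> 'g fword \<Rightarrow> 'v \<Rightarrow> 'v" where
  "word_action E (FWord gs) = foldr E gs"

lemma word_action_plus: "word_action E (u + w) v = word_action E u (word_action E w v)"
  by (cases u; cases w) simp

lemma word_action_0 [simp]: "word_action E 0 v = v"
  by (simp add: zero_fword_def)

lemma poly_mapping_single_induct [case_names add single]:
  assumes "\<And>f g. P f \<Longrightarrow> P g \<Longrightarrow> P (f + g)" "\<And>k c. P (Poly_Mapping.single k c)"
  shows "P (f :: 'a \<Rightarrow>\<^sub>0 'b::comm_monoid_add)"
proof -
  have "P (\<Sum>k\<in>A. Poly_Mapping.single k (Poly_Mapping.lookup f k))" if "finite A" for A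
    \<comment> \<open>The empty sum is a \<open>single\<close> with coefficient 0.\<close>
    using that assms(2)[of undefined 0] by induction (auto intro: assms)
  from this[of "Poly_Mapping.keys f"]
  have "P (\<Sum>k\<in>Poly_Mapping.keys f. Poly_Mapping.single k (Poly_Mapping.lookup f k))" by simp
  also have "(\<Sum>k\<in>Poly_Mapping.keys f. Poly_Mapping.single k (Poly_Mapping.lookup f k)) = f"
    by (rule poly_mapping_eqI)
      (auto simp: lookup_sum lookup_single when_def in_keys_iff)
  finally show ?thesis .
qed

lemma sum_keys_superset:
  assumes "finite A" "Poly_Mapping.keys d \<subseteq> A" "\<And>k. f k 0 = 0"
  shows "(\<Sum>k\<in>Poly_Mapping.keys d. f k (Poly_Mapping.lookup d k)) =
    (\<Sum>k\<in>A. f k (Poly_Mapping.lookup d k))"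
  using assms by (intro sum.mono_neutral_left) (auto simp: in_keys_iff)

text \<open>The universal property of the free algebra: words act by composing the operators of
  their letters, and linear combinations of words act linearly. Multiplicativity is checked on
  single words, where the product is concatenation.\<close>

lemma free_algebra_module_exists:
  fixes scale :: "complex \<Rightarrow> 'v::ab_group_add \<Rightarrow> 'v"
  assumes "vector_space scale" and lin: "\<And>g :: 'g. Vector_Spaces.linear scale scale (E g)"
  shows "\<exists>act :: 'g free_algebra \<Rightarrow> 'v \<Rightarrow> 'v.
    free_algebra_module scale act \<and> (\<forall>g. act (gen g) = E g)"
proof -
  define act where "act u v = (\<Sum>w\<in>Poly_Mapping.keys u.
    scale (Poly_Mapping.lookup u w) (word_action E w v))" for u v
  interpret vector_space scale by fact
  interpret vector_space_pair scale scale ..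
  have lin_word: "Vector_Spaces.linear scale scale (word_action E w)" for w
  proof (cases w)
    case (FWord gs)
    have "Vector_Spaces.linear scale scale (foldr E gs)"
    proof (induction gs)
      case (Cons g gs)
      show ?case using Vector_Spaces.linear_compose[OF Cons lin[of g]] by (simp add: comp_def)
    qed (simp, unfold_locales, auto)
    with FWord show ?thesis by simp
  qed
  have act_single: "act (Poly_Mapping.single w c) v = scale c (word_action E w v)" for w c v
    by (simp add: act_def)
  have act_add: "act (u + u') v = act u v + act u' v" for u u' v
  proof -
    let ?A = "Poly_Mapping.keys u \<union> Poly_Mapping.keys u'"
    have *: "act x v = (\<Sum>w\<in>?A. scale (Poly_Mapping.lookup x w) (word_action E w v))"
      if "Poly_Mapping.keys x \<subseteq> ?A" for x
      unfolding act_def using that by (intro sum_keys_superset) auto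
    have "Poly_Mapping.keys (u + u') \<subseteq> ?A"
      by (rule Poly_Mapping.keys_add)
    then show ?thesis
      by (simp add: * lookup_add scale_left_distrib sum.distrib)
  qed
  have lin_act: "Vector_Spaces.linear scale scale (act u)" for u
  proof (induction u rule: poly_mapping_single_induct)
    case (add f g)
    then have "Vector_Spaces.linear scale scale (\<lambda>v. act f v + act g v)"
      by (rule linear_compose_add)
    then show ?case by (simp add: act_add[abs_def])
  next
    case (single w c)
    have "Vector_Spaces.linear scale scale (\<lambda>v. scale c (word_action E w v))"
      using lin_word by (rule linear_compose_scale_right)
    then show ?case by (simp add: act_single[abs_def])
  qed
  have mult_single: "act (Poly_Mapping.single w c * u') v = act (Poly_Mapping.single w c) (act u' v)"
    for w c u' v
  proof (induction u' rule: poly_mapping_single_induct)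
    case (add f g)
    then show ?case
      using linear_add[OF lin_act]
      by (simp add: distrib_left act_add)
  next
    case (single w' c')
    then show ?case
      using linear_scale[OF lin_word]
      by (simp add: Poly_Mapping.mult_single act_single word_action_plus)
  qed
  have mult: "act (u * u') v = act u (act u' v)" for u u' v
    by (induction u rule: poly_mapping_single_induct) (auto simp: act_add distrib_right mult_single)
  have "free_algebra_module scale act"
    by unfold_locales (auto simp: act_add mult scal_def act_single linear_add[OF lin_act] linear_scale[OF lin_act])
  moreover have "act (gen g) = E g" for g
    by (rule ext) (simp add: gen_def act_single)
  ultimately show ?thesis by blast
qed

subsection \<open>The series occurring as eigenvalues\<close>

text \<open>The witness is the logarithm of f: \<open>fps_ln 1\<close> is the series of log(1 + Z),
  the compositional inverse of exp(Z) - 1, and f - 1 may be substituted because its constant term is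
  0.\<close>

lemma fps_exp_surj:
  assumes "fps_nth f 0 = (1::complex)"
  obtains g where "fps_nth g 0 = 0" "fps_exp 1 oo g = f"
proof
  have f0: "fps_nth (f - 1) 0 = 0" using assms by simp
  show "fps_nth (fps_ln 1 oo (f - 1)) 0 = 0" by simp
  have "(fps_exp 1 - 1) oo (fps_ln 1 oo (f - 1)) = ((fps_exp (1::complex) - 1) oo fps_ln 1) oo (f - 1)"
    by (rule fps_compose_assoc[OF f0]) simp
  also have "(fps_exp (1::complex) - 1) oo fps_ln 1 = fps_X"
    by (simp add: fps_ln_fps_exp_inv fps_inv_right)
  also have "fps_X oo (f - 1) = f - 1"
    using f0 by (simp add: fps_X_fps_compose_startby0)
  finally show "fps_exp 1 oo (fps_ln 1 oo (f - 1)) = f"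
    by (simp add: fps_compose_sub_distrib)
qed

text \<open>The expansion at \<open>z = 0\<close> (for \<open>s = Plus\<close>) or \<open>z = \<infinity>\<close> (for \<open>s = Minus\<close>) of
  \<open>(q\<^sup>w - q\<^bsup>-w\<^esup> g z) / (1 - g z)\<close>, which is \<open>\<psi>(g z)\<close>, \<open>1\<close>, \<open>\<psi>(g q\<^sup>2 z)\<inverse>\<close> for
  \<open>w = 1, 0, -1\<close>.\<close>

definition psi_wt :: "complex \<Rightarrow> pm \<Rightarrow> int \<Rightarrow> complex \<Rightarrow> complex fps" where
  "psi_wt t s w g = Abs_fps (\<lambda>n. if n = 0 then exp t powi (sg s * w)
     else of_int (sg s) * (exp t powi w - exp t powi (- w)) * g powi (sg s * int n))"

lemma psi_wt_nth_Plus: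
  "fps_nth (psi_wt t Plus w g) n =
    (if n = 0 then exp t powi w else (exp t powi w - exp t powi (- w)) * g ^ n)"
  by (simp add: psi_wt_def)

lemma psi_wt_nth_Minus:
  "fps_nth (psi_wt t Minus w g) n =
    (if n = 0 then exp t powi (- w) else - (exp t powi w - exp t powi (- w)) * inverse g ^ n)"
  by (simp add: psi_wt_def power_int_minus power_inverse)

text \<open>Links the coefficient list to the rational function. From degree 1 on the coefficients
  are geometric with ratio g, so multiplication by 1 - g z leaves only degrees 0 and 1.\<close>

lemma psi_wt_mult_Plus:
  "psi_wt t Plus w g * (1 - fps_const g * fps_X) =
    fps_const (exp t powi w) - fps_const (exp t powi (- w) * g) * fps_X"
proof (rule fps_ext)
  fix n
  have "psi_wt t Plus w g * (1 - fps_const g * fps_X) =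
      psi_wt t Plus w g - fps_const g * (psi_wt t Plus w g * fps_X)"
    by (simp add: right_diff_distrib mult_ac)
  then have *: "fps_nth (psi_wt t Plus w g * (1 - fps_const g * fps_X)) n =
      fps_nth (psi_wt t Plus w g) n - g * (if n = 0 then 0 else fps_nth (psi_wt t Plus w g) (n - 1))"
    by simp
  consider "n = 0" | "n = 1" | k where "n = Suc (Suc k)"
    by (metis One_nat_def not0_implies_Suc)
  then show "fps_nth (psi_wt t Plus w g * (1 - fps_const g * fps_X)) n =
    fps_nth (fps_const (exp t powi w) - fps_const (exp t powi (- w) * g) * fps_X) n"
    unfolding * psi_wt_nth_Plus by cases (simp_all add: algebra_simps)
qed

lemma psi_wt_mult_Minus:
  assumes "g \<noteq> 0"
  shows "psi_wt t Minus w g * (fps_X - fps_const g) =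
    fps_const (exp t powi w) * fps_X - fps_const (exp t powi (- w) * g)"
proof (rule fps_ext)
  fix n
  have "psi_wt t Minus w g * (fps_X - fps_const g) =
      psi_wt t Minus w g * fps_X - fps_const g * psi_wt t Minus w g"
    by (simp add: right_diff_distrib mult.commute[of _ "fps_const g"])
  then have *: "fps_nth (psi_wt t Minus w g * (fps_X - fps_const g)) n =
      (if n = 0 then 0 else fps_nth (psi_wt t Minus w g) (n - 1)) - g * fps_nth (psi_wt t Minus w g) n"
    by simp
  have g: "g * (inverse g * x) = x" "g * (x * inverse g) = x" for x
    using assms by simp_all
  consider "n = 0" | "n = 1" | k where "n = Suc (Suc k)"
    by (metis One_nat_def not0_implies_Suc)
  then show "fps_nth (psi_wt t Minus w g * (fps_X - fps_const g)) n =
    fps_nth (fps_const (exp t powi w) * fps_X - fps_const (exp t powi (- w) * g)) n"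
    unfolding * psi_wt_nth_Minus
    by cases (simp_all add: left_diff_distrib right_diff_distrib g mult_ac assms)
qed

lemma psi_eq_psi_wt:
  assumes "g \<noteq> 0" shows "psi t s g = psi_wt t s 1 g"
proof (cases s)
  case Plus
  let ?d = "1 - fps_const g * fps_X"
  have "fps_nth ?d 0 \<noteq> 0" by simp
  then have "?d \<noteq> 0" by force
  have "psi t Plus g = psi_wt t Plus 1 g * ?d / ?d"
    unfolding psi_wt_mult_Plus by (simp add: power_int_minus)
  also have "\<dots> = psi_wt t Plus 1 g"
    using \<open>?d \<noteq> 0\<close> by (rule nonzero_mult_div_cancel_right)
  finally show ?thesis using Plus by simp
next
  case Minus
  let ?d = "fps_X - fps_const g"
  have "fps_nth ?d 0 \<noteq> 0" using assms by simp
  then have "?d \<noteq> 0" by force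
  have "psi t Minus g = psi_wt t Minus 1 g * ?d / ?d"
    unfolding psi_wt_mult_Minus[OF assms] by (simp add: power_int_minus)
  also have "\<dots> = psi_wt t Minus 1 g"
    using \<open>?d \<noteq> 0\<close> by (rule nonzero_mult_div_cancel_right)
  finally show ?thesis using Minus by simp
qed

lemma psi_wt_0: "psi_wt t s 0 g = 1"
  by (rule fps_ext) (simp add: psi_wt_def)

text \<open>The shift by q^2 makes each numerator proportional to the other denominator: the factors
  are q (1 - g z)/(1 - q^2 g z) and q^(-1) (1 - q^2 g z)/(1 - g z).\<close>

lemma inverse_psi_eq_psi_wt:
  assumes "g \<noteq> 0" shows "inverse (psi t s (g * exp t ^ 2)) = psi_wt t s (- 1) g"
proof (rule fps_inverse_unique)
  let ?q = "exp t" and ?h = "g * exp t ^ 2"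
  have h: "?h \<noteq> 0" using assms by simp
  \<comment> \<open>The product of the fractions n/d and n'/d', stated without division of power
    series.\<close>
  have eq: "x * y = 1" if "x * d = n" "y * d' = n'" "n * n' = d * d'" "d \<noteq> 0" "d' \<noteq> 0"
    for x y d d' n n' :: "complex fps"
  proof -
    have "(x * y) * (d * d') = 1 * (d * d')"
      using that by (metis mult.assoc mult.commute mult.left_commute mult_1)
    with that show ?thesis by (metis mult_cancel_right no_zero_divisors)
  qed
  show "psi t s ?h * psi_wt t s (- 1) g = 1"
  proof (cases s)
    case Plus
    have nz: "1 - fps_const c * fps_X \<noteq> 0" for c :: complex
    proof
      assume "1 - fps_const c * fps_X = 0"
      then have "fps_nth (1 - fps_const c * fps_X) 0 = 0" by simp
      then show False by simp
    qed
    show ?thesis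
      unfolding psi_eq_psi_wt[OF h] Plus
      by (rule eq[OF psi_wt_mult_Plus psi_wt_mult_Plus _ nz nz])
        (rule fps_ext; simp add: algebra_simps power_int_minus power2_eq_square
          flip: fps_const_mult fps_const_add fps_const_sub)
  next
    case Minus
    have nz: "fps_X - fps_const c \<noteq> 0" if "c \<noteq> 0" for c :: complex
    proof
      assume "fps_X - fps_const c = 0"
      then have "fps_nth (fps_X - fps_const c) 0 = 0" by simp
      with that show False by simp
    qed
    show ?thesis
      unfolding psi_eq_psi_wt[OF h] Minus
      by (rule eq[OF psi_wt_mult_Minus[OF h] psi_wt_mult_Minus[OF assms] _ nz[OF h] nz[OF assms]])
        (simp add: algebra_simps power_int_minus power2_eq_square)
  qed
qed

section \<open>Coefficients of the eigenvalue series and exchange identities\<close>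

definition psi_coeff :: "complex \<Rightarrow> pm \<Rightarrow> int \<Rightarrow> complex \<Rightarrow> int \<Rightarrow> complex" where
  "psi_coeff t s w g m = (if 0 \<le> sg s * m then fps_nth (psi_wt t s w g) (nat (sg s * m)) else 0)"

lemma psi_coeff_Plus:
  "psi_coeff t Plus w g m = (if m < 0 then 0 else if m = 0 then exp t powi w
     else (exp t powi w - exp t powi (- w)) * g powi m)"
  by (auto simp: psi_coeff_def psi_wt_def)

lemma psi_coeff_Minus:
  "psi_coeff t Minus w g m = (if m > 0 then 0 else if m = 0 then exp t powi (- w)
     else - (exp t powi w - exp t powi (- w)) * g powi m)"
  by (auto simp: psi_coeff_def psi_wt_def)

text \<open>The expansions of one rational function at 0 and at infinity differ by a multiple of a
  delta series, which is the shape of the commutator of x_i^+ and x_i^-.\<close>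

lemma psi_coeff_diff:
  "psi_coeff t Plus w g m - psi_coeff t Minus w g m = (exp t powi w - exp t powi (- w)) * g powi m"
  by (auto simp: psi_coeff_Plus psi_coeff_Minus algebra_simps)

text \<open>Coefficientwise form of \<open>(1 - c d z) F'(z) = (c - d z) F(z)\<close>.\<close>

lemma psi_coeff_exchange:
  assumes "g \<noteq> 0" "g' \<noteq> 0" "d \<noteq> 0" and c: "c = exp t powi (w' - w)"
    and w': "w' = 0 \<or> g' = c * d" and w: "w = 0 \<or> d = c * g" and "w = 0 \<or> w' = 0"
  shows "psi_coeff t e w' g' m - c * d * psi_coeff t e w' g' (m - 1) =
    c * psi_coeff t e w g m - d * psi_coeff t e w g (m - 1)"
proof -
  have q: "exp t \<noteq> 0" by simp
  have c0: "c \<noteq> 0" using c by simp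
  have pw: "x powi m = x * x powi (m - 1)" if "x \<noteq> 0" for x :: complex
    using that power_int_add[of x 1 "m - 1"] by simp
  \<comment> \<open>A series of weight 0 equals 1. If the other weight is non-zero, its pole
    condition lets one of the two linear factors cancel the remaining denominator.\<close>
  consider "w = 0" "w' = 0" | "w = 0" "w' \<noteq> 0" | "w \<noteq> 0" "w' = 0" using assms(7) by blast
  then show ?thesis
  proof cases
    case 1
    then show ?thesis using c by (cases e) (auto simp: psi_coeff_Plus psi_coeff_Minus)
  next
    case 2
    then have g': "g' = c * d" using w' by simp
    show ?thesis
      using 2 c pw[of g'] assms(2) unfolding g'
      by (cases e) (auto simp: psi_coeff_Plus psi_coeff_Minus field_simps power_int_minus)
  next
    case 3
    then have d: "d = c * g" using w by simp
    show ?thesis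
      using 3 c pw[of g] assms(1) unfolding d
      by (cases e) (auto simp: psi_coeff_Plus psi_coeff_Minus field_simps power_int_minus)
  qed
qed

text \<open>The case of the node that is moved itself, where the weight changes sign and the pole
  stays. Both sides come from q^(-s) (1 - q^(2s) g z)(q^(2s) - g z)/(1 - g z).\<close>

lemma psi_coeff_exchange_same:
  assumes "g \<noteq> 0" and s: "\<bar>s\<bar> = 1"
  shows "psi_coeff t e s g m - exp t powi (2 * s) * g * psi_coeff t e s g (m - 1) =
    exp t powi (2 * s) * psi_coeff t e (- s) g m - g * psi_coeff t e (- s) g (m - 1)"
proof -
  have pw: "g powi m = g * g powi (m - 1)"
    using assms power_int_add[of g 1 "m - 1"] by simp
  have "s = 1 \<or> s = - 1" using s by linarith
  then show ?thesis
    using assms(1) pw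
    by (cases e) (auto simp: psi_coeff_Plus psi_coeff_Minus field_simps power_int_minus
      power2_eq_square eval_nat_numeral)
qed

subsection \<open>Moving an entry of a tableau\<close>

definition entries_below :: "int \<Rightarrow> int set \<Rightarrow> int" where
  "entries_below i A = int (card {x\<in>A. x < i})"

text \<open>The value at h_i of the weight of A.\<close>

definition node_wt :: "int set \<Rightarrow> int \<Rightarrow> int" where
  "node_wt A i = of_bool (i \<in> A) - of_bool (i + 1 \<in> A)"

fun source :: "pm \<Rightarrow> int \<Rightarrow> int" where
  "source Plus i = i + 1"
| "source Minus i = i"

fun target :: "pm \<Rightarrow> int \<Rightarrow> int" where
  "target Plus i = i"
| "target Minus i = i + 1"

definition movable :: "pm \<Rightarrow> int \<Rightarrow> int set \<Rightarrow> bool" where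
  "movable s i A \<longleftrightarrow> source s i \<in> A \<and> target s i \<notin> A"

definition move :: "pm \<Rightarrow> int \<Rightarrow> int set \<Rightarrow> int set" where
  "move s i A = insert (target s i) (A - {source s i})"

lemma entries_below_Suc:
  assumes "finite A"
  shows "entries_below (i + 1) A = entries_below i A + of_bool (i \<in> A)"
proof -
  have "{x\<in>A. x < i + 1} = (if i \<in> A then insert i {x\<in>A. x < i} else {x\<in>A. x < i})"
    by (auto simp: le_less)
  then show ?thesis using assms by (simp add: entries_below_def)
qed

text \<open>The threshold j + 1 is the only one that separates the positions j and j + 1.\<close>

lemma entries_below_move:
  assumes A: "finite A" and mv: "movable s j A"
  shows "entries_below i (move s j A) = entries_below i A + (if i = j + 1 then sg s else 0)"
proof -
  let ?s = "source s j" and ?t = "target s j"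
  have eq: "{x\<in>move s j A. x < i} =
      (if ?t < i then insert ?t ({x\<in>A. x < i} - {?s}) else {x\<in>A. x < i} - {?s})"
    by (auto simp: move_def)
  have st: "?s \<in> A" "?t \<notin> A" using mv by (auto simp: movable_def)
  have c: "int (card ({x\<in>A. x < i} - {?s})) = int (card {x\<in>A. x < i}) - of_bool (?s < i)"
  proof (cases "?s < i")
    case True
    then have "?s \<in> {x\<in>A. x < i}" using st by simp
    then show ?thesis
      using True A card_Suc_Diff1[of "{x\<in>A. x < i}" ?s] by simp
  qed simp
  show ?thesis
    unfolding entries_below_def eq using st A c by (cases s) auto
qed

lemma finite_move [simp]: "finite (move s i A) = finite A"
  by (simp add: move_def)

lemma card_move:
  assumes "finite A" "movable s i A" shows "card (move s i A) = card A"
  using assms card_Suc_Diff1[of A "source s i"]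
  by (auto simp: move_def movable_def)

lemma node_wt_move:
  assumes "movable s j A"
  shows "node_wt (move s j A) i = node_wt A i + sg s * cartan_mat i j"
proof -
  consider "i = j" | "i = j + 1" | "i = j - 1" | "i \<noteq> j" "i \<noteq> j + 1" "i + 1 \<noteq> j" by linarith
  then show ?thesis
    using assms by cases (cases s; auto simp: node_wt_def move_def movable_def cartan_mat_def)+
qed

lemma movable_wt: "movable s i A \<longleftrightarrow> node_wt A i = - sg s"
  by (cases s) (auto simp: node_wt_def movable_def)

lemma node_wt_cases: "node_wt A i \<in> {-1, 0, 1}"
  by (auto simp: node_wt_def)

lemma movable_opp_move:
  "movable s i A \<Longrightarrow> movable (opp s) i (move s i A)"
  by (cases s) (auto simp: movable_def move_def)

lemma move_opp_move:
  "movable s i A \<Longrightarrow> move (opp s) i (move s i A) = A"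
  by (cases s) (auto simp: movable_def move_def)

lemma movable_twice: "\<not> movable s i (move s i A)"
  by (cases s) (auto simp: movable_def move_def)

text \<open>A second move at i would need its source refilled and its target vacated, and a single
  move at j of the same sign does not do both. This kills the middle Serre term.\<close>

lemma movable_thrice:
  "movable s i A \<Longrightarrow> movable s j (move s i A) \<Longrightarrow> \<not> movable s i (move s j (move s i A))"
  by (cases s) (auto simp: movable_def move_def)

lemma movable_far:
  assumes "\<bar>i - j\<bar> \<ge> 2" shows "movable s i (move s' j A) \<longleftrightarrow> movable s i A"
  using assms by (cases s; cases s') (auto simp: movable_def move_def)

text \<open>The two nodes share one position, which after the first move is either a vacated source
  or an occupied target for the second. Hence both products in the commutator of x_i^+ and x_j^-
  vanish separately.\<close>

lemma not_movable_opp_adjacent: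
  assumes "\<bar>i - j\<bar> = 1" "movable s j A" shows "\<not> movable (opp s) i (move s j A)"
proof -
  consider "i = j + 1" | "i = j - 1" using assms(1) by linarith
  then show ?thesis
    using assms by cases (cases s; auto simp: movable_def move_def)+
qed

lemma move_commute_far:
  assumes "\<bar>i - j\<bar> \<ge> 2" "movable s i A" "movable s' j A"
  shows "move s i (move s' j A) = move s' j (move s i A)"
  using assms by (cases s; cases s') (auto simp: movable_def move_def)

lemma sum_move:
  fixes f :: "int \<Rightarrow> 'a::ab_group_add"
  assumes "finite A" "movable s i A"
  shows "(\<Sum>e\<in>move s i A. f e) = (\<Sum>e\<in>A. f e) + f (target s i) - f (source s i)"
  using assms by (auto simp: move_def movable_def sum_diff1)

section \<open>Behaviour of the poles under moves\<close>

definition node_param :: "complex \<Rightarrow> complex \<Rightarrow> nat \<Rightarrow> int set \<Rightarrow> int \<Rightarrow> complex" where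
  "node_param t a l A i = a * exp t powi (i + int l - 1 - 2 * entries_below i A)"

context
  fixes t a :: complex and l :: nat
  assumes a_nonzero: "a \<noteq> 0"
begin

abbreviation "np \<equiv> node_param t a l"

lemma node_param_nonzero: "np A i \<noteq> 0"
  using a_nonzero by (simp add: node_param_def)

lemma node_param_move:
  assumes "finite A" "movable s j A" "i \<noteq> j + 1"
  shows "np (move s j A) i = np A i"
  using assms by (simp add: node_param_def entries_below_move)

text \<open>The ratio of the two poles in a product of adjacent currents is the one at which the
  linear factor of the quadratic relation vanishes.\<close>

lemma node_param_move_adjacent:
  assumes A: "finite A" and ij: "\<bar>i - j\<bar> = 1" and m: "movable s j A" "movable s i (move s j A)"
  shows "np (move s j A) i = exp t powi (sg s * cartan_mat i j) * np A j"
proof -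
  have *: "i + int l - 1 - 2 * entries_below i (move s j A) =
     sg s * cartan_mat i j + (j + int l - 1 - 2 * entries_below j A)"
  proof -
    consider "i = j + 1" | "j = i + 1" using ij by linarith
    then show ?thesis
    proof cases
      case 1
      then show ?thesis
        using m entries_below_move[OF A m(1), of i] entries_below_Suc[OF A, of j]
        by (cases s) (auto simp: movable_def move_def cartan_mat_def)
    next
      case 2
      then show ?thesis
        using m entries_below_move[OF A m(1), of i] entries_below_Suc[OF A, of i]
        by (cases s) (auto simp: movable_def move_def cartan_mat_def)
    qed
  qed
  show ?thesis
    unfolding node_param_def * by (simp add: power_int_add mult_ac)
qed

text \<open>The relation between phi_i(z) and x_j(w) on one basis vector. With d the parameter of A
  at j, the current x_j(w) is a delta series supported at w = 1/d, which leaves (1 - c d z) F'(z) =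
  (c - d z) F(z) for the eigenvalues F and F' before and after the move.\<close>

lemma psi_coeff_move:
  fixes s i j A
  assumes A: "finite A" and m: "movable s j A"
  defines "c \<equiv> exp t powi (sg s * cartan_mat i j)"
  defines "A' \<equiv> move s j A"
  shows "psi_coeff t e (node_wt A' i) (np A' i) n
      - c * np A j * psi_coeff t e (node_wt A' i) (np A' i) (n - 1) =
    c * psi_coeff t e (node_wt A i) (np A i) n
      - np A j * psi_coeff t e (node_wt A i) (np A i) (n - 1)"
proof -
  have wt: "node_wt A' i = node_wt A i + sg s * cartan_mat i j"
    unfolding A'_def by (rule node_wt_move[OF m])
  have c: "c = exp t powi (node_wt A' i - node_wt A i)" by (simp add: wt c_def)
  \<comment> \<open>Proportionality of two parameters is reduced to an identity between integer
    exponents, in which a and l cancel.\<close>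
  have npI: "np B h = c * np B' h'"
    if "h - 2 * entries_below h B = h' - 2 * entries_below h' B' + sg s * cartan_mat i j" for B h B' h'
  proof -
    have *: "h + int l - 1 - 2 * entries_below h B =
        (h' + int l - 1 - 2 * entries_below h' B') + sg s * cartan_mat i j"
      using that by simp
    show ?thesis
      unfolding node_param_def c_def * by (simp add: power_int_add)
  qed
  consider "i = j" | "i = j + 1" | "j = i + 1" | "\<bar>i - j\<bar> \<ge> 2" by linarith
  then show ?thesis
  proof cases
    case 1
    have np': "np A' i = np A i" unfolding A'_def by (rule node_param_move[OF A m]) (simp add: 1)
    have "node_wt A i = - sg s" "node_wt A' i = sg s" "cartan_mat i j = 2"
      using m wt 1 by (auto simp: movable_wt cartan_mat_def)
    then show ?thesis
      using psi_coeff_exchange_same[OF node_param_nonzero[of A i], of "sg s" t e n] np' 1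
      by (cases s) (auto simp: c_def mult_ac)
  next
    case 4
    have "np A' i = np A i" unfolding A'_def by (rule node_param_move[OF A m]) (use 4 in auto)
    moreover have "cartan_mat i j = 0" using 4 by (auto simp: cartan_mat_def)
    ultimately show ?thesis using wt by (simp add: c_def)
  next
    case 2
    have b: "entries_below i A = entries_below j A + of_bool (j \<in> A)"
      "entries_below i A' = entries_below i A + sg s"
      using entries_below_Suc[OF A, of j] entries_below_move[OF A m, of i] 2 by (auto simp: A'_def)
    have C: "cartan_mat i j = - 1" using 2 by (simp add: cartan_mat_def)
    have mem: "j \<in> A \<longleftrightarrow> s = Minus"
      "node_wt A i = of_bool (s = Plus) - of_bool (i + 1 \<in> A)"
      using m 2 by (cases s; simp add: movable_def node_wt_def)+
    \<comment> \<open>For adjacent nodes the two weights differ by 1 and lie in {-1, 0, 1}, so one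
      of them is 0 and at most one pole condition has content.\<close>
    have "node_wt A' i = 0 \<or>
        i - 2 * entries_below i A' = j - 2 * entries_below j A + sg s * cartan_mat i j"
      "node_wt A i = 0 \<or>
        j - 2 * entries_below j A = i - 2 * entries_below i A + sg s * cartan_mat i j"
      "node_wt A i = 0 \<or> node_wt A' i = 0"
      unfolding wt mem(2) C b(2) b(1) using 2 mem(1) by (cases s; cases "i + 1 \<in> A"; simp)+
    then show ?thesis
      by (intro psi_coeff_exchange[OF node_param_nonzero node_param_nonzero node_param_nonzero c])
        (auto intro: npI)
  next
    case 3
    have b: "entries_below j A = entries_below i A + of_bool (i \<in> A)"
      "entries_below i A' = entries_below i A"
      using entries_below_Suc[OF A, of i] entries_below_move[OF A m, of i] 3 by (auto simp: A'_def)
    have C: "cartan_mat i j = - 1" using 3 by (simp add: cartan_mat_def)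
    have mem: "node_wt A i = of_bool (i \<in> A) - of_bool (s = Minus)"
      using m 3 by (cases s; simp add: movable_def node_wt_def)
    have "node_wt A' i = 0 \<or>
        i - 2 * entries_below i A' = j - 2 * entries_below j A + sg s * cartan_mat i j"
      "node_wt A i = 0 \<or>
        j - 2 * entries_below j A = i - 2 * entries_below i A + sg s * cartan_mat i j"
      "node_wt A i = 0 \<or> node_wt A' i = 0"
      unfolding wt mem C b(2) b(1) using 3 by (cases s; cases "i \<in> A"; simp)+
    then show ?thesis
      by (intro psi_coeff_exchange[OF node_param_nonzero node_param_nonzero node_param_nonzero c])
        (auto intro: npI)
  qed
qed

end

subsection \<open>The basis indexed by finite sets\<close>

lemma sorted_list_of_set_tableau:
  assumes "T \<in> tableaux l" shows "sorted_list_of_set (set T) = T"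
  using assms by (simp add: tableaux_def sorted_list_of_set.idem_if_sorted_distinct strict_sorted_iff)

lemma entries_below_nth:
  assumes "sorted_wrt (<) T" "k < length T"
  shows "entries_below (T ! k) (set T) = int k"
proof -
  have *: "T ! j < T ! k \<longleftrightarrow> j < k" if "j < length T" for j
    using assms that sorted_wrt_nth_less[OF assms(1)]
    by (metis linorder_neqE_nat order_less_asym order_less_irrefl)
  have "{x\<in>set T. x < T ! k} = (!) T ` {..<k}"
  proof (intro equalityI subsetI)
    fix x assume "x \<in> {x\<in>set T. x < T ! k}"
    then obtain j where "j < length T" "T ! j = x" "x < T ! k" by (auto simp: in_set_conv_nth)
    then show "x \<in> (!) T ` {..<k}" using * by blast
  next
    fix x assume "x \<in> (!) T ` {..<k}"
    then obtain j where j: "j < k" "x = T ! j" by blast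
    then have "j < length T" using assms(2) by simp
    then show "x \<in> {x\<in>set T. x < T ! k}" using * j by simp
  qed
  moreover have "inj_on ((!) T) {..<k}"
    using assms by (intro inj_on_nth) (auto simp: strict_sorted_iff)
  ultimately show ?thesis by (simp add: entries_below_def card_image)
qed

lemma entries_below_entry:
  assumes "T \<in> tableaux l" "p \<in> {1..l}"
  shows "entries_below (entry T p) (set T) = int p - 1"
  using entries_below_nth[of T "p - 1"] assms by (auto simp: tableaux_def entry_def)

lemma entry_in_set: "T \<in> tableaux l \<Longrightarrow> p \<in> {1..l} \<Longrightarrow> entry T p \<in> set T"
  by (auto simp: tableaux_def entry_def)

lemma exists_entry:
  assumes "T \<in> tableaux l" "e \<in> set T" obtains p where "p \<in> {1..l}" "entry T p = e"
proof -
  obtain k where "k < length T" "T ! k = e" using assms(2) by (auto simp: in_set_conv_nth)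
  then show ?thesis using that[of "Suc k"] assms(1) by (auto simp: tableaux_def entry_def)
qed

text \<open>Entries are distinct, so at most one position contributes; it is recovered from the set
  alone as one plus the number of smaller entries.\<close>

lemma sum_entry:
  fixes f :: "nat \<Rightarrow> 'a::comm_monoid_add"
  assumes T: "T \<in> tableaux l"
  shows "(\<Sum>p=1..l. if entry T p = e then f p else 0) =
    (if e \<in> set T then f (nat (entries_below e (set T) + 1)) else 0)"
proof (cases "e \<in> set T")
  case True
  then obtain p where p: "p \<in> {1..l}" "entry T p = e" using exists_entry[OF T] by blast
  have *: "nat (entries_below e (set T) + 1) = p" using entries_below_entry[OF T p(1)] p(2) by simp
  have "(\<Sum>k=1..l. if entry T k = e then f k else 0) = (\<Sum>k\<in>{1..l}. if k = p then f k else 0)"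
  proof (intro sum.cong refl)
    fix k assume k: "k \<in> {1..l}"
    have "k = p" if "entry T k = e"
    proof -
      have "int k - 1 = int p - 1"
        unfolding entries_below_entry[OF T k, symmetric] entries_below_entry[OF T p(1), symmetric]
          that p(2) ..
      then show ?thesis by simp
    qed
    then have "entry T k = e \<longleftrightarrow> k = p" using p(2) by blast
    then show "(if entry T k = e then f k else 0) = (if k = p then f k else 0)" by simp
  qed
  then show ?thesis using True p(1) * by simp
next
  case False
  then have "(\<Sum>p=1..l. if entry T p = e then f p else 0) = 0"
    using entry_in_set[OF T] by (intro sum.neutral) auto
  then show ?thesis using False by simp
qed

text \<open>Source and target are neighbours and the target is absent, so no other entry is met or
  overtaken and the list stays strictly increasing.\<close>

lemma replace_entry_tableau:
  assumes T: "T \<in> tableaux l" and m: "movable s i (set T)"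
  shows "\<exists>T'\<in>tableaux l. replace_entry (source s i) (target s i) T = Some T' \<and>
    set T' = move s i (set T)"
proof -
  let ?f = "\<lambda>k. if k = source s i then target s i else k"
  have st: "source s i \<in> set T" "target s i \<notin> set T" using m by (auto simp: movable_def)
  have mono: "?f x < ?f y" if "x \<in> set T" "y \<in> set T" "x < y" for x y
  proof -
    have "x \<noteq> target s i" "y \<noteq> target s i" using st that by auto
    then show ?thesis using that(3) by (cases s) auto
  qed
  have "sorted_wrt (\<lambda>x y. ?f x < ?f y) T"
    by (rule sorted_wrt_mono_rel[of T "(<)"]) (use mono T in \<open>auto simp: tableaux_def\<close>)
  then have "map ?f T \<in> tableaux l"
    using T by (auto simp: tableaux_def sorted_wrt_map)
  moreover have "set (map ?f T) = move s i (set T)"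
    using st by (auto simp: move_def)
  ultimately show ?thesis using st by (auto simp: replace_entry_def)
qed

lemma qpow_add: "qpow t (r + r') = qpow t r * qpow t r'"
  by (simp add: qpow_def of_rat_add distrib_left exp_add)

lemma qpow_0 [simp]: "qpow t 0 = 1"
  by (simp add: qpow_def)

lemma qpow_of_int: "qpow t (of_int n) = exp t powi n"
  by (simp add: qpow_def exp_power_int mult.commute)

locale tableau_space = vector_space scale
  for scale :: "complex \<Rightarrow> 'v::ab_group_add \<Rightarrow> 'v" +
  fixes t a :: complex and l :: nat and b :: "int list \<Rightarrow> 'v"
  assumes q_not_root: "\<forall>n>0. exp t ^ n \<noteq> 1"
    and a_nonzero: "a \<noteq> 0"
    and basis: "tableau_basis scale l b"
begin

abbreviation param :: "int set \<Rightarrow> int \<Rightarrow> complex" where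
  "param \<equiv> node_param t a l"

definition columns :: "int set set" where
  "columns = {A. finite A \<and> card A = l}"

definition cvec :: "int set \<Rightarrow> 'v" where
  "cvec A = b (sorted_list_of_set A)"

lemma columns_finite: "A \<in> columns \<Longrightarrow> finite A"
  by (simp add: columns_def)

lemma columns_move: "A \<in> columns \<Longrightarrow> movable s i A \<Longrightarrow> move s i A \<in> columns"
  by (simp add: columns_def card_move)

lemma tableaux_eq: "tableaux l = sorted_list_of_set ` columns"
proof -
  have "T \<in> sorted_list_of_set ` columns" if "T \<in> tableaux l" for T
    using that sorted_list_of_set_tableau[OF that]
    by (intro image_eqI[of _ _ "set T"])
      (auto simp: columns_def tableaux_def strict_sorted_iff distinct_card)
  then show ?thesis by (auto simp: columns_def tableaux_def)
qed

lemma set_in_columns: "T \<in> tableaux l \<Longrightarrow> set T \<in> columns"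
  by (auto simp: columns_def tableaux_def strict_sorted_iff distinct_card)

lemma cvec_set: "T \<in> tableaux l \<Longrightarrow> cvec (set T) = b T"
  by (simp add: cvec_def sorted_list_of_set_tableau)

lemma inj_cvec: "inj_on cvec columns"
proof -
  have "inj_on b (sorted_list_of_set ` columns)"
    using basis by (simp add: tableau_basis_def tableaux_eq)
  moreover have "inj_on sorted_list_of_set columns"
    by (intro inj_onI) (metis columns_finite sorted_list_of_set.set_sorted_key_list_of_set)
  ultimately show ?thesis
    using comp_inj_on[of sorted_list_of_set columns b] by (simp add: cvec_def[abs_def] comp_def)
qed

lemma cvec_image: "cvec ` columns = b ` tableaux l"
  by (auto simp: cvec_def tableaux_eq)

lemma independent_cvec: "independent (cvec ` columns)"
  using basis by (simp add: cvec_image tableau_basis_def)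

lemma span_cvec: "span (cvec ` columns) = UNIV"
  using basis by (simp add: cvec_image tableau_basis_def)

lemma linear_extension:
  "\<exists>E. Vector_Spaces.linear scale scale E \<and> (\<forall>A\<in>columns. E (cvec A) = X A)"
proof -
  interpret vector_space_pair scale scale ..
  obtain E where "Vector_Spaces.linear scale scale E"
    "\<forall>x\<in>cvec ` columns. E x = X (the_inv_into columns cvec x)"
    using linear_independent_extend[OF independent_cvec, of "\<lambda>x. X (the_inv_into columns cvec x)"]
    by auto
  then show ?thesis by (auto simp: the_inv_into_f_f[OF inj_cvec])
qed

lemma linear_eq_0:
  assumes "Vector_Spaces.linear scale scale f" "\<And>A. A \<in> columns \<Longrightarrow> f (cvec A) = 0"
  shows "f v = 0"
proof -
  interpret f: Vector_Spaces.linear scale scale f by fact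
  have "v \<in> span (cvec ` columns)" by (simp add: span_cvec)
  then show ?thesis
    by (induction rule: span_induct_alt) (auto simp: assms(2) f.add f.scale)
qed

lemma q_ne_inverse: "exp t - inverse (exp t) \<noteq> 0"
proof
  assume "exp t - inverse (exp t) = 0"
  then have "exp t * exp t = 1" by (metis eq_iff_diff_eq_0 exp_not_eq_zero right_inverse)
  then show False using q_not_root by (metis power2_eq_square zero_less_numeral)
qed

lemma param_nonzero: "param A i \<noteq> 0"
  using a_nonzero by (rule node_param_nonzero)

definition x_image :: "pm \<Rightarrow> int \<Rightarrow> int \<Rightarrow> int set \<Rightarrow> 'v" where
  "x_image s i r A = (if movable s i A then scale (param A i powi r) (cvec (move s i A)) else 0)"

definition column_module :: "(uq_free \<Rightarrow> 'v \<Rightarrow> 'v) \<Rightarrow> bool" where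
  "column_module act \<longleftrightarrow> uq_module t scale act \<and>
     (\<forall>A\<in>columns. \<forall>s i r. act (gx s i r) (cvec A) = x_image s i r A) \<and>
     (\<forall>A\<in>columns. \<forall>s i n. act (fps_nth (phi t s i) n) (cvec A) =
        scale (fps_nth (psi_wt t s (node_wt A i) (param A i)) n) (cvec A))"

lemma vec_of_replace_entry:
  assumes T: "T \<in> tableaux l"
  shows "vec_of b (replace_entry (source s i) (target s i) T) =
    (if movable s i (set T) then cvec (move s i (set T)) else 0)"
proof (cases "movable s i (set T)")
  case True
  then show ?thesis
    using replace_entry_tableau[OF T True] by (auto simp: vec_of_def cvec_set[symmetric])
next
  case False
  then show ?thesis by (auto simp: vec_of_def replace_entry_def movable_def)
qed

lemma x_image_tableau:
  assumes T: "T \<in> tableaux l"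
  shows "(\<Sum>p=1..l. if entry T p = source s i
       then scale ((a * exp t powi (i + int l + 1 - 2 * int p)) powi r)
              (vec_of b (replace_entry (source s i) (target s i) T))
       else 0) = x_image s i r (set T)"
proof -
  let ?A = "set T"
  have fin: "finite ?A" by simp
  \<comment> \<open>The moved entry has p - 1 smaller ones. If it is i + 1, then i is absent, so p -
    1 counts the entries below i in this case too.\<close>
  have *: "i + int l + 1 - 2 * int (nat (entries_below (source s i) ?A + 1)) =
      i + int l - 1 - 2 * entries_below i ?A" if "movable s i ?A"
    using that entries_below_Suc[OF fin, of i]
    by (cases s) (auto simp: movable_def entries_below_def)
  show ?thesis
  proof (cases "movable s i ?A")
    case True
    then have "source s i \<in> ?A" by (simp add: movable_def)
    then show ?thesis
      unfolding sum_entry[OF T] vec_of_replace_entry[OF T] *[OF True] x_image_def node_param_def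
      using True by (simp only: if_True)
  next
    case False
    then show ?thesis
      unfolding sum_entry[OF T] vec_of_replace_entry[OF T] x_image_def by simp
  qed
qed

lemma param_entry:
  assumes T: "T \<in> tableaux l" and p: "p \<in> {1..l}" and m: "movable s i (set T)"
    and e: "entry T p = source s i"
  shows "param (set T) i = a * exp t powi (i + int l + 1 - 2 * int p)"
proof -
  have "entries_below i (set T) = int p - 1"
    using entries_below_entry[OF T p] entries_below_Suc[of "set T" i] m e
    by (cases s) (auto simp: movable_def)
  then have "i + int l - 1 - 2 * entries_below i (set T) = i + int l + 1 - 2 * int p" by simp
  then show ?thesis unfolding node_param_def by (simp only:)
qed

text \<open>Translates the module formulas from lists to sets; the three cases for phi_i are the
  node weights -1, 1 and 0.\<close>

lemma is_V_module_iff: "is_V_module t l a scale b act \<longleftrightarrow> column_module act"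
proof -
  have A: "(\<forall>A\<in>columns. P A (cvec A)) \<longleftrightarrow> (\<forall>T\<in>tableaux l. P (set T) (b T))" for P
    by (metis (no_types, lifting) cvec_set imageE set_in_columns sorted_list_of_set.set_sorted_key_list_of_set
      columns_finite tableaux_eq image_eqI)
  have x: "(\<forall>A\<in>columns. \<forall>s i r. act (gx s i r) (cvec A) = x_image s i r A) \<longleftrightarrow>
      (\<forall>T\<in>tableaux l. \<forall>s i r. act (gx s i r) (b T) = x_image s i r (set T))"
    by (rule A)
  have ph: "(\<forall>A\<in>columns. \<forall>s i n. act (fps_nth (phi t s i) n) (cvec A) =
        scale (fps_nth (psi_wt t s (node_wt A i) (param A i)) n) (cvec A)) \<longleftrightarrow>
      (\<forall>T\<in>tableaux l. \<forall>s i n. act (fps_nth (phi t s i) n) (b T) =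
        scale (fps_nth (psi_wt t s (node_wt (set T) i) (param (set T) i)) n) (b T))"
    by (rule A)
  have plus: "x_image Plus i r (set T) = (\<Sum>p=1..l. if entry T p = i + 1
       then scale ((a * exp t powi (i + int l + 1 - 2 * int p)) powi r) (vec_of b (te i T)) else 0)"
    if "T \<in> tableaux l" for i r T
    using x_image_tableau[OF that, of Plus i r, unfolded source.simps target.simps]
    by (simp only: te_def)
  have minus: "x_image Minus i r (set T) = (\<Sum>p=1..l. if entry T p = i
       then scale ((a * exp t powi (i + int l + 1 - 2 * int p)) powi r) (vec_of b (tf i T)) else 0)"
    if "T \<in> tableaux l" for i r T
    using x_image_tableau[OF that, of Minus i r, unfolded source.simps target.simps]
    by (simp only: tf_def)
  have phi: "((\<forall>p\<in>{1..l}. entry T p = i + 1 \<and> i \<notin> set T \<longrightarrow>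
           act (fps_nth (phi t s i) n) (b T) =
             scale (fps_nth (inverse (psi t s (a * exp t powi (i + int l + 3 - 2 * int p)))) n) (b T)) \<and>
        (\<forall>p\<in>{1..l}. entry T p = i \<and> i + 1 \<notin> set T \<longrightarrow>
           act (fps_nth (phi t s i) n) (b T) =
             scale (fps_nth (psi t s (a * exp t powi (i + int l + 1 - 2 * int p))) n) (b T)) \<and>
        ((i \<in> set T \<longleftrightarrow> i + 1 \<in> set T) \<longrightarrow>
           act (fps_nth (phi t s i) n) (b T) = scale (fps_nth 1 n) (b T))) \<longleftrightarrow>
      act (fps_nth (phi t s i) n) (b T) =
        scale (fps_nth (psi_wt t s (node_wt (set T) i) (param (set T) i)) n) (b T)"
    (is "?L \<longleftrightarrow> ?R") if T: "T \<in> tableaux l" for T s i n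
  proof -
    consider "movable Plus i (set T)" | "movable Minus i (set T)" | "i \<in> set T \<longleftrightarrow> i + 1 \<in> set T"
      by (auto simp: movable_def)
    then show ?thesis
    proof cases
      case 1
      then obtain p where p: "p \<in> {1..l}" "entry T p = i + 1"
        using exists_entry[OF T] by (auto simp: movable_def)
      \<comment> \<open>The prescribed exponent i + l + 3 - 2p exceeds that of \<open>param\<close>
        by 2, the shift in \<open>inverse_psi_eq_psi_wt\<close>.\<close>
      have *: "inverse (psi t s (a * exp t powi (i + int l + 3 - 2 * int p'))) =
          psi_wt t s (- 1) (param (set T) i)" if "p' \<in> {1..l}" "entry T p' = i + 1" for p'
      proof -
        have e: "i + int l + 3 - 2 * int p' = (i + int l + 1 - 2 * int p') + 2" by simp
        have "exp t powi (i + int l + 3 - 2 * int p') = exp t powi (i + int l + 1 - 2 * int p') * exp t ^ 2"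
          unfolding e by (subst power_int_add) auto
        then have "a * exp t powi (i + int l + 3 - 2 * int p') = param (set T) i * exp t ^ 2"
          using param_entry[OF T that(1) 1] that(2) by simp
        then show ?thesis using inverse_psi_eq_psi_wt[OF param_nonzero] by simp
      qed
      have "node_wt (set T) i = - 1" "i \<notin> set T" "i + 1 \<in> set T"
        using 1 by (auto simp: movable_wt[symmetric] movable_def node_wt_def)
      then show ?thesis using * p entry_in_set[OF T] by auto
    next
      case 2
      then obtain p where p: "p \<in> {1..l}" "entry T p = i"
        using exists_entry[OF T] by (auto simp: movable_def)
      have *: "psi t s (a * exp t powi (i + int l + 1 - 2 * int p')) =
          psi_wt t s 1 (param (set T) i)" if "p' \<in> {1..l}" "entry T p' = i" for p'
        using param_entry[OF T that(1) 2] that(2) psi_eq_psi_wt[OF param_nonzero]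
        by (metis source.simps(2))
      have "node_wt (set T) i = 1" "i \<in> set T" "i + 1 \<notin> set T"
        using 2 by (auto simp: movable_def node_wt_def)
      then show ?thesis using * p entry_in_set[OF T] by auto
    next
      case 3
      then have wt: "node_wt (set T) i = 0" by (auto simp: node_wt_def)
      have none: "\<not> (entry T p = i + 1 \<and> i \<notin> set T)" "\<not> (entry T p = i \<and> i + 1 \<notin> set T)"
        if "p \<in> {1..l}" for p
        using 3 entry_in_set[OF T that] by metis+
      show ?thesis
        unfolding wt psi_wt_0 using 3 none by blast
    qed
  qed
  have pm: "(\<forall>s. P s) \<longleftrightarrow> P Plus \<and> P Minus" for P by (metis pm.exhaust)
  show ?thesis
    unfolding is_V_module_def column_module_def x ph
    using plus minus phi by (auto simp: pm)
qed

end

subsection \<open>Existence of the module\<close>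

text \<open>Assumes the action of x and phi only, neither that of k_h and h_(i,m) nor the relators.
  It therefore serves both while the action is being constructed and for a given module.\<close>

locale column_representation = tableau_space scale t a l b + free_algebra_module scale act
  for scale :: "complex \<Rightarrow> 'v::ab_group_add \<Rightarrow> 'v" and t a :: complex and l :: nat
    and b :: "int list \<Rightarrow> 'v" and act :: "uq_free \<Rightarrow> 'v \<Rightarrow> 'v" +
  assumes act_gx: "A \<in> columns \<Longrightarrow> act (gx s i r) (cvec A) = x_image s i r A"
    and act_phi: "A \<in> columns \<Longrightarrow> act (fps_nth (phi t s i) n) (cvec A) =
        scale (fps_nth (psi_wt t s (node_wt A i) (param A i)) n) (cvec A)"
begin

lemma act_phi_coeff:
  "A \<in> columns \<Longrightarrow> act (phi_coeff t s i m) (cvec A) =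
     scale (psi_coeff t s (node_wt A i) (param A i) m) (cvec A)"
  by (simp add: phi_coeff_def psi_coeff_def act_phi)

lemma act_gx_gx:
  assumes "A \<in> columns"
  shows "act (gx s i m) (act (gx s' j r) (cvec A)) =
    (if movable s' j A \<and> movable s i (move s' j A)
     then scale (param A j powi r * param (move s' j A) i powi m) (cvec (move s i (move s' j A)))
     else 0)"
  using assms by (auto simp: act_gx x_image_def act.scale columns_move)

lemma gx_commute_far:
  assumes A: "A \<in> columns" and ij: "\<bar>i - j\<bar> \<ge> 2"
  shows "act (gx s i m) (act (gx s' j r) (cvec A)) = act (gx s' j r) (act (gx s i m) (cvec A))"
proof -
  have ji: "\<bar>j - i\<bar> \<ge> 2" using ij by linarith
  have np: "param (move s' j A) i = param A i" if "movable s' j A"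
    using that ij columns_finite[OF A] by (intro node_param_move a_nonzero) auto
  have np': "param (move s i A) j = param A j" if "movable s i A"
    using that ij columns_finite[OF A] by (intro node_param_move a_nonzero) auto
  show ?thesis
    using move_commute_far[OF ij, of s A s']
    by (auto simp: act_gx_gx[OF A] movable_far[OF ij] movable_far[OF ji] np np' mult.commute)
qed

lemma gx_gx_same: "A \<in> columns \<Longrightarrow> act (gx s i m) (act (gx s i r) (cvec A)) = 0"
  by (simp add: act_gx_gx movable_twice)

lemma gx_gx_gx:
  "A \<in> columns \<Longrightarrow> act (gx s i m) (act (gx s j r) (act (gx s i n) (cvec A))) = 0"
  using movable_thrice[of s i A j]
  by (auto simp: act_gx x_image_def act.scale columns_move)

text \<open>For i = j every product of two such operators vanishes. For adjacent nodes each bracket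
  vanishes by itself, by the ratio of the poles. For distant nodes c = 1, and the operators commute
  with unchanged poles.\<close>

lemma relator_x_x:
  assumes A: "A \<in> columns" and c: "c = exp t powi (sg s * cartan_mat i j)"
  shows "act ((gx s i m * gx s j (r - 1) - scal c * gx s i (m - 1) * gx s j r)
        - (scal c * gx s j (r - 1) * gx s i m - gx s j r * gx s i (m - 1))) (cvec A) = 0"
proof -
  have pw: "x powi n = x * x powi (n - 1)" if "x \<noteq> 0" for x :: complex and n
    using that power_int_add[of x 1 "n - 1"] by simp
  consider "i = j" | "\<bar>i - j\<bar> = 1" | "\<bar>i - j\<bar> \<ge> 2" by linarith
  then show ?thesis
  proof cases
    case 1
    then show ?thesis by (simp add: act_diff act_mult gx_gx_same[OF A])
  next
    case 2
    then have ji: "\<bar>j - i\<bar> = 1" and C: "cartan_mat j i = cartan_mat i j"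
      by (auto simp: cartan_mat_def)
    have ij: "act (gx s i m * gx s j (r - 1) - scal c * gx s i (m - 1) * gx s j r) (cvec A) = 0"
    proof (cases "movable s j A \<and> movable s i (move s j A)")
      case True
      then have "param (move s j A) i = c * param A j"
        unfolding c by (intro node_param_move_adjacent a_nonzero columns_finite[OF A] 2) auto
      then show ?thesis
        using True pw[OF param_nonzero, of A j r] pw[OF param_nonzero, of "move s j A" i m]
        by (simp add: act_diff act_mult act_gx_gx[OF A] mult_ac)
    qed (auto simp: act_diff act_mult act_gx_gx[OF A])
    have ji: "act (scal c * gx s j (r - 1) * gx s i m - gx s j r * gx s i (m - 1)) (cvec A) = 0"
    proof (cases "movable s i A \<and> movable s j (move s i A)")
      case True
      then have "param (move s i A) j = c * param A i"
        unfolding c C[symmetric] by (intro node_param_move_adjacent a_nonzero columns_finite[OF A] ji) auto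
      then show ?thesis
        using True pw[OF param_nonzero, of A i m] pw[OF param_nonzero, of "move s i A" j r]
        by (simp add: act_diff act_mult act_gx_gx[OF A] mult_ac)
    qed (auto simp: act_diff act_mult act_gx_gx[OF A])
    show ?thesis using ij ji by (simp add: act_diff[of "_ - _" "_ - _"])
  next
    case 3
    then have "c = 1" by (auto simp: c cartan_mat_def)
    then have c1: "scal c = 1" by (simp add: scal_def)
    have ji: "\<bar>j - i\<bar> \<ge> 2" using 3 by linarith
    have np: "param (move s j A) i = param A i" if "movable s j A"
      using that 3 columns_finite[OF A] by (intro node_param_move a_nonzero) auto
    define Z where "Z = act (gx s i 0) (act (gx s j 0) (cvec A))"
    have prod: "act (gx s i m') (act (gx s j r') (cvec A)) =
        scale (param A j powi r' * param A i powi m') Z" for m' r'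
      by (simp add: Z_def act_gx_gx[OF A] np)
    have "act (gx s j r') (act (gx s i m') (cvec A)) = act (gx s i m') (act (gx s j r') (cvec A))"
      for m' r'
      by (rule gx_commute_far[OF A ji])
    then show ?thesis
      unfolding c1 act_diff act_mult using prod pw[OF param_nonzero, of A j r] pw[OF param_nonzero, of A i m]
      by (simp add: mult_ac)
  qed
qed

lemma relator_phi_x:
  assumes A: "A \<in> columns" and c: "c = exp t powi (sg s * cartan_mat i j)"
  shows "act ((phi_coeff t e i m * gx s j (r - 1) - scal c * phi_coeff t e i (m - 1) * gx s j r)
        - (scal c * gx s j (r - 1) * phi_coeff t e i m - gx s j r * phi_coeff t e i (m - 1))) (cvec A)
     = 0"
proof (cases "movable s j A")
  case True
  let ?A' = "move s j A" and ?d = "param A j"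
  have pw: "?d powi r = ?d * ?d powi (r - 1)"
    using param_nonzero power_int_add[of ?d 1 "r - 1"] by simp
  let ?F = "psi_coeff t e (node_wt A i) (param A i)"
  let ?F' = "psi_coeff t e (node_wt ?A' i) (param ?A' i)"
  have "act ((phi_coeff t e i m * gx s j (r - 1) - scal c * phi_coeff t e i (m - 1) * gx s j r)
        - (scal c * gx s j (r - 1) * phi_coeff t e i m - gx s j r * phi_coeff t e i (m - 1))) (cvec A)
     = scale (?d powi (r - 1) * ((?F' m - c * ?d * ?F' (m - 1)) - (c * ?F m - ?d * ?F (m - 1))))
         (cvec ?A')"
    using True A columns_move[OF A True]
    by (simp add: act_diff act_mult act_gx x_image_def act_phi_coeff act.scale pw;
      simp add: scale_left_diff_distrib right_diff_distrib mult_ac)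
  also have "\<dots> = 0"
    using psi_coeff_move[OF a_nonzero columns_finite[OF A] True, where i = i and e = e and n = m and t = t and l = l]
    by (simp add: c)
  finally show ?thesis .
next
  case False
  then show ?thesis
    using A by (simp add: act_diff act_mult act_gx x_image_def act_phi_coeff act.scale)
qed

lemma relator_xp_xm:
  assumes A: "A \<in> columns"
  shows "act (commutator (gx Plus i m) (gx Minus j r)
        - (if i = j
           then scal (1 / (exp t - inverse (exp t)))
                * (phi_coeff t Plus i (m + r) - phi_coeff t Minus i (m + r))
           else 0)) (cvec A) = 0"
proof -
  consider "i = j" | "\<bar>i - j\<bar> = 1" | "\<bar>i - j\<bar> \<ge> 2" by linarith
  then show ?thesis
  proof cases
    case 1
    have rhs: "act (scal (1 / (exp t - inverse (exp t)))
          * (phi_coeff t Plus i (m + r) - phi_coeff t Minus i (m + r))) (cvec A) =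
        scale (of_int (node_wt A i) * param A i powi (m + r)) (cvec A)"
    proof -
      \<comment> \<open>A q-integer of w equals w for w = -1, 0, 1.\<close>
      have "(exp t powi node_wt A i - exp t powi (- node_wt A i)) / (exp t - inverse (exp t)) =
          of_int (node_wt A i)"
        using node_wt_cases[of A i] q_ne_inverse by (auto simp: power_int_minus field_simps)
      then have "(exp t powi node_wt A i - exp t powi (- node_wt A i)) * x / (exp t - inverse (exp t)) =
          of_int (node_wt A i) * x" for x
        by (metis times_divide_eq_left)
      then show ?thesis
        by (simp add: act_mult act_diff act_phi_coeff[OF A] scale_left_diff_distrib[symmetric]
            psi_coeff_diff)
    qed
    have np: "param (move s i A) i = param A i" if "movable s i A" for s
      using that columns_finite[OF A] by (intro node_param_move a_nonzero) auto
    have wt: "movable Plus i A \<longleftrightarrow> node_wt A i = - 1" "movable Minus i A \<longleftrightarrow> node_wt A i = 1"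
      by (simp_all add: movable_wt)
    have mv: "movable Minus i (move Plus i A)" "move Minus i (move Plus i A) = A"
      if "movable Plus i A"
      using movable_opp_move[OF that] move_opp_move[OF that] by simp_all
    have mv': "movable Plus i (move Minus i A)" "move Plus i (move Minus i A) = A"
      if "movable Minus i A"
      using movable_opp_move[OF that] move_opp_move[OF that] by simp_all
    have p: "param A i powi (m + r) = param A i powi m * param A i powi r"
      using param_nonzero by (simp add: power_int_add)
    \<comment> \<open>At most one of the two products is non-zero; it returns A, and its sign in the
      commutator is the weight.\<close>
    consider "node_wt A i = - 1" | "node_wt A i = 0" | "node_wt A i = 1"
      using node_wt_cases[of A i] by blast
    then show ?thesis
      unfolding 1[symmetric] if_P[OF refl] act_diff[of "commutator _ _"] rhs
      using wt mv mv' np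
      by cases (simp_all add: act_commutator act_gx_gx[OF A] p mult_ac)
  next
    case 2
    then have ji: "\<bar>j - i\<bar> = 1" by linarith
    show ?thesis
      using 2 not_movable_opp_adjacent[OF 2, of Minus A] not_movable_opp_adjacent[OF ji, of Plus A]
      by (auto simp: act_commutator act_gx_gx[OF A])
  next
    case 3
    then show ?thesis
      by (auto simp: act_commutator gx_commute_far[OF A 3])
  qed
qed

text \<open>Each of the three terms vanishes on its own, before symmetrization: the outer two
  contain consecutive moves at i, the middle one is \<open>gx_gx_gx\<close>.\<close>

lemma relator_serre:
  assumes A: "A \<in> columns"
  shows "act (serre t s i j m n r) (cvec A) = 0"
proof -
  have "act (gx s i m) (act (gx s i n) (act (gx s j r) (cvec A))) = 0"
    using A by (simp add: act_gx x_image_def act.scale columns_move movable_twice)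
  then show ?thesis
    by (simp add: serre_def act_add act_diff act_mult gx_gx_gx[OF A] gx_gx_same[OF A])
qed

end

text \<open>This is q^(lambda(h)) for the weight lambda of A, to which an entry e contributes
  Lambda_e - Lambda_(e-1).\<close>

definition (in tableau_space) k_eigenvalue :: "cartan \<Rightarrow> int set \<Rightarrow> complex" where
  "k_eigenvalue h A =
     qpow t (\<Sum>e\<in>A. Poly_Mapping.lookup h e - Poly_Mapping.lookup h (e - 1))"

context tableau_space
begin

lemma k_eigenvalue_add: "k_eigenvalue (h + h') A = k_eigenvalue h A * k_eigenvalue h' A"
  by (simp add: k_eigenvalue_def qpow_add[symmetric] lookup_add sum.distrib[symmetric] algebra_simps)

lemma k_eigenvalue_0: "k_eigenvalue 0 A = 1"
  by (simp add: k_eigenvalue_def)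

lemma k_eigenvalue_coroot:
  assumes "finite A"
  shows "k_eigenvalue (if s = Plus then coroot i else - coroot i) A = exp t powi (sg s * node_wt A i)"
proof -
  have "(\<Sum>e\<in>A. Poly_Mapping.lookup (coroot i) e) = of_int (of_bool (i \<in> A))"
    using assms by (simp add: coroot_def lookup_single when_def)
  moreover have "(\<Sum>e\<in>A. Poly_Mapping.lookup (coroot i) (e - 1)) = of_int (of_bool (i + 1 \<in> A))"
  proof -
    have "(\<Sum>e\<in>A. Poly_Mapping.lookup (coroot i) (e - 1)) = (\<Sum>e\<in>A. if i + 1 = e then 1 else 0)"
      by (intro sum.cong) (auto simp: coroot_def lookup_single when_def)
    then show ?thesis using assms by simp
  qed
  ultimately have *: "(\<Sum>e\<in>A. Poly_Mapping.lookup (coroot i) e - Poly_Mapping.lookup (coroot i) (e - 1))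
      = of_int (node_wt A i)"
    by (simp add: sum_subtractf node_wt_def)
  have "(\<Sum>e\<in>A. - Poly_Mapping.lookup (coroot i) e + Poly_Mapping.lookup (coroot i) (e - 1))
      = of_int (- node_wt A i)"
    using * by (simp add: sum_subtractf sum.distrib sum_negf)
  with * show ?thesis
    by (cases s) (simp_all add: k_eigenvalue_def qpow_of_int[symmetric] del: of_int_minus)
qed

lemma k_eigenvalue_move:
  assumes "finite A" "movable s j A"
  shows "k_eigenvalue h (move s j A) = k_eigenvalue h A * qpow t (of_int (sg s) * alpha j h)"
  using assms
  by (cases s) (simp_all add: k_eigenvalue_def sum_move qpow_add[symmetric] alpha_def Lam_def algebra_simps)

lemma h_eigenvalues_exist:
  "\<exists>g. fps_nth g 0 = 0 \<and> fps_const (exp t powi (sg s * w)) * (fps_exp 1 oo g) = psi_wt t s w d"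
proof -
  let ?c = "exp t powi (sg s * w)"
  have "fps_nth (fps_const (inverse ?c) * psi_wt t s w d) 0 = 1" by (simp add: psi_wt_def)
  then obtain g where "fps_nth g 0 = 0" "fps_exp 1 oo g = fps_const (inverse ?c) * psi_wt t s w d"
    using fps_exp_surj by blast
  moreover have "fps_const ?c * (fps_const (inverse ?c) * psi_wt t s w d) = psi_wt t s w d"
    by (simp add: mult.assoc[symmetric] del: mult.assoc)
  ultimately show ?thesis by metis
qed

lemma column_module_exists: "\<exists>act. column_module act"
proof -
  define G where "G s i A = (SOME g. fps_nth g 0 = 0 \<and>
    fps_const (exp t powi (sg s * node_wt A i)) * (fps_exp 1 oo g) =
      psi_wt t s (node_wt A i) (param A i))" for s i A
  have G0: "fps_nth (G s i A) 0 = 0"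
    and G: "fps_const (exp t powi (sg s * node_wt A i)) * (fps_exp 1 oo G s i A) =
      psi_wt t s (node_wt A i) (param A i)" for s i A
    using someI_ex[OF h_eigenvalues_exist[of s "node_wt A i" "param A i"]]
    by (simp_all add: G_def)
  \<comment> \<open>The sign of m selects the expansion. For m = 0 this is the vanishing constant
    term of the logarithm, so the discarded letter \<open>GH i 0\<close> acts by 0.\<close>
  define hv where "hv i m A = (let s = (if m > 0 then Plus else Minus) in
    fps_nth (G s i A) (nat \<bar>m\<bar>) / (of_int (sg s) * (exp t - inverse (exp t))))" for i m A
  define X where "X g A = (case g of GX s i r \<Rightarrow> x_image s i r A
    | GK h \<Rightarrow> scale (k_eigenvalue h A) (cvec A) | GH i m \<Rightarrow> scale (hv i m A) (cvec A))" for g A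
  obtain E where E: "\<And>g. Vector_Spaces.linear scale scale (E g)"
    "\<And>g A. A \<in> columns \<Longrightarrow> E g (cvec A) = X g A"
    using linear_extension[of "X _"] by metis
  obtain act :: "uq_free \<Rightarrow> 'v \<Rightarrow> 'v" where act: "free_algebra_module scale act" "\<And>g. act (gen g) = E g"
    using free_algebra_module_exists[OF vector_space_axioms, of E] E(1) by auto
  interpret free_algebra_module scale act by (rule act(1))
  have gk: "act (gk h) (cvec A) = scale (k_eigenvalue h A) (cvec A)" if "A \<in> columns" for h A
    using that by (simp add: gk_def act E X_def)
  have gh: "act (gh i m) (cvec A) = scale (hv i m A) (cvec A)" if "A \<in> columns" for i m A
    using that by (simp add: gh_def act E X_def)
  have gx: "act (gx s i r) (cvec A) = x_image s i r A" if "A \<in> columns" for s i r A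
    using that by (simp add: gx_def act E X_def)
  have phi: "eigen_series (phi t s i) (psi_wt t s (node_wt A i) (param A i)) (cvec A)"
    if A: "A \<in> columns" for s i A
  proof -
    let ?u = "of_int (sg s) * (exp t - inverse (exp t))"
    have u: "?u \<noteq> 0" using q_ne_inverse by (cases s) auto
    have GH: "fps_const ?u * Abs_fps (\<lambda>m. if m = 0 then 0 else hv i (sg s * int m) A) = G s i A"
    proof (rule fps_ext)
      fix n
      show "fps_nth (fps_const ?u * Abs_fps (\<lambda>m. if m = 0 then 0 else hv i (sg s * int m) A)) n =
          fps_nth (G s i A) n"
        using u by (cases s) (auto simp: G0 hv_def)
    qed
    have "eigen_series (phi t s i)
      (fps_const (exp t powi (sg s * node_wt A i)) * (Abs_fps (\<lambda>n. 1 / fact n) oo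
        (fps_const ?u * Abs_fps (\<lambda>m. if m = 0 then 0 else hv i (sg s * int m) A)))) (cvec A)"
      unfolding phi_def
      by (intro eigen_series_mult eigen_series_const eigen_series_compose eigen_series_Abs_fps)
        (use A in \<open>auto simp: gk gh k_eigenvalue_coroot[OF columns_finite]\<close>)
    also have "Abs_fps (\<lambda>n. 1 / fact n) = fps_exp (1::complex)"
      by (rule fps_ext) simp
    finally show ?thesis unfolding GH G .
  qed
  interpret column_representation scale t a l b act
    by unfold_locales (use gx phi in \<open>auto simp: eigen_series_def\<close>)
  have "act u (cvec A) = 0" if u: "u \<in> uq_relators t" and A: "A \<in> columns" for u A
    using u
  proof cases
    case (h_zero i)
    then show ?thesis using A by (simp add: gh hv_def G0)
  next
    case (k_add h h')
    then show ?thesis using A by (simp add: act_diff act_mult gk act.scale k_eigenvalue_add mult.commute)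
  next
    case k_zero
    then show ?thesis using A by (simp add: act_diff gk k_eigenvalue_0)
  next
    case (k_k h h')
    then show ?thesis using A by (simp add: act_commutator gk act.scale mult.commute)
  next
    case (k_phi h s i m)
    then show ?thesis using A by (simp add: act_commutator gk act_phi_coeff act.scale mult.commute)
  next
    case (phi_phi s i m s' j n)
    then show ?thesis using A by (simp add: act_commutator act_phi_coeff act.scale mult.commute)
  next
    case (k_x h s j r)
    have "k_eigenvalue h A * k_eigenvalue (- h) A = 1"
      by (simp add: k_eigenvalue_add[symmetric] k_eigenvalue_0)
    then show ?thesis
      using A unfolding k_x
      by (cases "movable s j A")
        (simp_all add: act_diff act_mult gk gx x_image_def act.scale columns_move columns_finite
          k_eigenvalue_move mult_ac)
  next
    case (phi_x c s i j e m r)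
    then show ?thesis using relator_phi_x[OF A] by simp
  next
    case (xp_xm i m j r)
    then show ?thesis using relator_xp_xm[OF A] by simp
  next
    case (x_x c s i j m r)
    then show ?thesis using relator_x_x[OF A] by simp
  next
    case (serre_adjacent i j s m n r)
    then show ?thesis by (simp add: act_add relator_serre[OF A])
  next
    case (x_x_far i j s m r)
    then show ?thesis using gx_commute_far[OF A] by (simp add: act_commutator)
  qed
  then have "act u v = 0" if "u \<in> uq_relators t" for u v
    using that linear_eq_0[OF linear_act] by blast
  then have "uq_module t scale act"
    by (simp add: uq_module_def vector_space_axioms linear_act act_add act_mult)
  then show ?thesis using gx act_phi by (auto simp: column_module_def)
qed

end

subsection \<open>The action of the Cartan part\<close>

text \<open>At the largest element of the symmetric difference the sets agree one step higher, so
  the weights there differ.\<close>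

lemma node_wt_inj:
  assumes fin: "finite A" "finite B" and wt: "\<And>i. node_wt A i = node_wt B i"
  shows "A = B"
proof (rule ccontr)
  let ?D = "(A - B) \<union> (B - A)"
  assume "A \<noteq> B"
  then have D: "finite ?D" "?D \<noteq> {}" using fin by auto
  have "Max ?D + 1 \<notin> ?D" using Max_ge[OF D(1), of "Max ?D + 1"] by auto
  moreover have "Max ?D \<in> ?D" by (rule Max_in[OF D])
  ultimately show False
    using wt[of "Max ?D"] by (auto simp: node_wt_def of_bool_def split: if_splits)
qed

definition column_wt :: "int set \<Rightarrow> weight" where
  "column_wt A = (\<Sum>e\<in>A. Poly_Mapping.single e 1 - Poly_Mapping.single (e - 1) 1)"

lemma lookup_column_wt:
  assumes "finite A" shows "Poly_Mapping.lookup (column_wt A) i = node_wt A i"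
proof -
  have "Poly_Mapping.lookup (column_wt A) i =
      (\<Sum>e\<in>A. (if e = i then 1 else 0) - (if e = i + 1 then 1 else 0))"
    unfolding column_wt_def lookup_sum
    by (intro sum.cong) (auto simp: lookup_minus lookup_single when_def)
  then show ?thesis using assms by (simp add: sum_subtractf node_wt_def)
qed

locale column_uq_module = tableau_space scale t a l b
  for scale :: "complex \<Rightarrow> 'v::ab_group_add \<Rightarrow> 'v" and t a :: complex and l :: nat
    and b :: "int list \<Rightarrow> 'v" +
  fixes act :: "uq_free \<Rightarrow> 'v \<Rightarrow> 'v"
  assumes column_module: "column_module act"
begin

lemma uq_module: "uq_module t scale act"
  using column_module by (simp add: column_module_def)

sublocale column_representation scale t a l b act
proof -
  have "free_algebra_module scale act"
    using uq_module unfolding uq_module_def free_algebra_module_def free_algebra_module_axioms_def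
    by blast
  moreover have "column_representation_axioms scale t a l b act"
    using column_module unfolding column_module_def column_representation_axioms_def by blast
  ultimately show "column_representation scale t a l b act"
    using tableau_space_axioms by (simp add: column_representation_def)
qed

lemma act_relator: "u \<in> uq_relators t \<Longrightarrow> act u v = 0"
  using uq_module by (simp add: uq_module_def)

lemma act_gk_add: "act (gk h) (act (gk h') v) = act (gk (h + h')) v"
  using act_relator[OF uq_relators.k_add, of h h' v] by (simp add: act_diff act_mult)

lemma act_gk_0: "act (gk 0) v = v"
  using act_relator[OF uq_relators.k_zero, of v] by (simp add: act_diff)

lemma act_gk_commute: "act (gk h) (act (gk h') v) = act (gk h') (act (gk h) v)"
  by (simp add: act_gk_add add.commute)

text \<open>The constant coefficient of phi_i is k_(h_i) or its inverse, so the formulas for phi_i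
  determine it.\<close>

lemma act_gk_coroot:
  assumes "A \<in> columns"
  shows "act (gk (if s = Plus then coroot i else - coroot i)) (cvec A) =
    scale (exp t powi (sg s * node_wt A i)) (cvec A)"
  using act_phi[OF assms, of s i 0]
  by (simp add: phi_def psi_wt_def act_mult)

text \<open>Applying the inverse of the constant coefficient of phi_i leaves the exponential of the
  h_(i,m), which thus preserves the line. Its scalar coefficients, with linear one equal to 1, allow
  the argument to be recovered.\<close>

lemma stable_line_gh:
  assumes A: "A \<in> columns" and "m \<noteq> 0"
  shows "gh i m \<in> stable_line (cvec A)"
proof -
  define s where "s = (if m > 0 then Plus else Minus)"
  let ?k = "\<lambda>s. gk (if s = Plus then coroot i else - coroot i)"
  let ?c = "of_int (sg s) * (exp t - inverse (exp t))"
  let ?F = "Abs_fps (\<lambda>n. scal (1 / fact n)) :: uq_free fps"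
  let ?G = "fps_const (scal ?c) * Abs_fps (\<lambda>m. if m = 0 then 0 else gh i (sg s * int m))"
  have FG: "fps_nth (?F oo ?G) n \<in> stable_line (cvec A)" for n
  proof -
    let ?c' = "fps_nth (psi_wt t s (node_wt A i) (param A i)) n"
    define w where "w = act (fps_nth (?F oo ?G) n) (cvec A)"
    have "act (?k s) w = scale ?c' (cvec A)"
      using act_phi[OF A, of s i n] by (simp add: phi_def act_mult w_def)
    moreover have "act (?k (opp s)) (act (?k s) w) = w"
      by (cases s) (simp_all add: act_gk_add act_gk_0)
    ultimately have "w = act (?k (opp s)) (scale ?c' (cvec A))"
      by simp
    also have "\<dots> = scale (?c' * exp t powi (sg (opp s) * node_wt A i)) (cvec A)"
      unfolding act.scale act_gk_coroot[OF A, of "opp s" i] by simp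
    finally show ?thesis unfolding w_def stable_line_def by blast
  qed
  have F: "fps_nth ?F n \<in> stable_line (cvec A)" for n
    by (simp add: stable_line_scal)
  have "fps_nth ?G n \<in> stable_line (cvec A)" for n
    by (rule stable_line_of_compose[OF F FG]) (simp_all add: scal_def)
  from this[of "nat \<bar>m\<bar>"] have "scal ?c * gh i m \<in> stable_line (cvec A)"
    using assms(2) by (auto simp: s_def)
  moreover have "?c \<noteq> 0" using q_ne_inverse by (cases s) auto
  ultimately show ?thesis by (rule stable_line_scal_mult)
qed

section \<open>Coordinates and weight spaces\<close>

definition coord :: "int set \<Rightarrow> 'v \<Rightarrow> complex" where
  "coord A v = representation (cvec ` columns) v (cvec A)"

lemma coord_add: "coord A (v + w) = coord A v + coord A w"
  by (simp add: coord_def representation_add[OF independent_cvec] span_cvec)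

lemma coord_scale: "coord A (scale c v) = c * coord A v"
  by (simp add: coord_def representation_scale[OF independent_cvec] span_cvec)

lemma coord_0: "coord A 0 = 0"
  by (simp add: coord_def representation_zero)

lemma coord_sum: "coord A (\<Sum>x\<in>X. f x) = (\<Sum>x\<in>X. coord A (f x))"
  by (induction X rule: infinite_finite_induct) (auto simp: coord_add coord_0)

lemma coord_cvec:
  "A \<in> columns \<Longrightarrow> B \<in> columns \<Longrightarrow> coord A (cvec B) = (if A = B then 1 else 0)"
  using inj_onD[OF inj_cvec, of A B]
  by (auto simp: coord_def representation_basis[OF independent_cvec])

lemma finite_coord: "finite {A\<in>columns. coord A v \<noteq> 0}"
proof -
  have "finite (cvec -` {x. representation (cvec ` columns) v x \<noteq> 0} \<inter> columns)"
    by (intro finite_vimage_IntI finite_representation inj_cvec)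
  then show ?thesis by (rule rev_finite_subset) (auto simp: coord_def)
qed

lemma sum_coord: "(\<Sum>A\<in>{A\<in>columns. coord A v \<noteq> 0}. scale (coord A v) (cvec A)) = v"
proof -
  have "{x. representation (cvec ` columns) v x \<noteq> 0} = cvec ` {A\<in>columns. coord A v \<noteq> 0}"
    using representation_ne_zero[of "cvec ` columns" v] by (auto simp: coord_def)
  moreover have "inj_on cvec {A\<in>columns. coord A v \<noteq> 0}"
    using inj_cvec by (rule inj_on_subset) auto
  ultimately show ?thesis
    using sum_nonzero_representation_eq[OF independent_cvec, of v]
    by (simp add: span_cvec sum.reindex coord_def)
qed

lemma coord_eqI:
  assumes "\<And>A. A \<in> columns \<Longrightarrow> coord A v = coord A w" shows "v = w"
proof -
  have "{A\<in>columns. coord A v \<noteq> 0} = {A\<in>columns. coord A w \<noteq> 0}" using assms by auto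
  then have "(\<Sum>A\<in>{A\<in>columns. coord A v \<noteq> 0}. scale (coord A v) (cvec A)) =
      (\<Sum>A\<in>{A\<in>columns. coord A w \<noteq> 0}. scale (coord A w) (cvec A))"
    using assms by (intro sum.cong) auto
  then show ?thesis by (simp add: sum_coord)
qed

lemma coord_act_gk:
  assumes A: "A \<in> columns"
  shows "coord A (act (gk (coroot i)) v) = exp t powi node_wt A i * coord A v"
proof -
  have "v \<in> span (cvec ` columns)" by (simp add: span_cvec)
  then show ?thesis
  proof (induction rule: span_induct_alt)
    case (step c x y)
    then obtain B where "B \<in> columns" "x = cvec B" by blast
    then show ?case
      using step act_gk_coroot[of B Plus i] A
      by (auto simp: act.add act.scale coord_add coord_scale coord_cvec distrib_left)
  qed (simp add: coord_0)
qed

lemma exp_powi_inj: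
  assumes "exp t powi m = exp t powi n" shows "m = n"
proof (rule ccontr)
  have *: False if "m < n" "exp t powi m = exp t powi n" for m n :: int
  proof -
    have "exp t powi (n - m) = 1"
      using that(2) by (simp add: power_int_diff)
    then have "exp t ^ nat (n - m) = 1" using that(1) by (simp add: power_int_def)
    then show False using q_not_root that(1) by auto
  qed
  assume "m \<noteq> n"
  then show False using *[of m n] *[of n m] assms by (metis linorder_neqE)
qed

lemma weight_space_coord:
  assumes v: "v \<in> weight_space t scale act \<nu>" and A: "A \<in> columns" and c: "coord A v \<noteq> 0"
  shows "\<nu> = column_wt A"
proof (rule poly_mapping_eqI)
  fix i
  have "exp t powi node_wt A i * coord A v = exp t powi Poly_Mapping.lookup \<nu> i * coord A v"
    using coord_act_gk[OF A, of i v] v by (auto simp: weight_space_def coord_scale)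
  then show "Poly_Mapping.lookup \<nu> i = Poly_Mapping.lookup (column_wt A) i"
    using c exp_powi_inj by (auto simp: lookup_column_wt columns_finite[OF A])
qed

lemma column_wt_inj:
  assumes "A \<in> columns" "B \<in> columns" "column_wt A = column_wt B" shows "A = B"
  using assms by (intro node_wt_inj) (auto simp: columns_finite lookup_column_wt[symmetric])

lemma weight_space_cvec:
  assumes A: "A \<in> columns" shows "scale c (cvec A) \<in> weight_space t scale act (column_wt A)"
  using act_gk_coroot[OF A, of Plus] columns_finite[OF A]
  by (auto simp: weight_space_def act.scale lookup_column_wt mult.commute)

text \<open>The formulas say nothing about k_h directly; it commutes with all k_(h_i), so it maps
  the basis vector of A into its weight space, which is a line.\<close>

lemma stable_line_gk:
  assumes A: "A \<in> columns" shows "gk h \<in> stable_line (cvec A)"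
proof -
  let ?w = "act (gk h) (cvec A)"
  have w: "?w \<in> weight_space t scale act (column_wt A)"
    using act_gk_coroot[OF A, of Plus] columns_finite[OF A]
    by (auto simp: weight_space_def act_gk_commute[of _ h] act.scale lookup_column_wt)
  have "coord B ?w = coord B (scale (coord A ?w) (cvec A))" if B: "B \<in> columns" for B
    using weight_space_coord[OF w B] column_wt_inj[OF A B] A B by (auto simp: coord_scale coord_cvec)
  then have "?w = scale (coord A ?w) (cvec A)" by (rule coord_eqI)
  then show ?thesis unfolding stable_line_def by blast
qed

subsection \<open>Integrability\<close>

lemma weight_decomposition_exists:
  "\<exists>d :: weight \<Rightarrow>\<^sub>0 'v. (\<forall>\<nu>. Poly_Mapping.lookup d \<nu> \<in> weight_space t scale act \<nu>) \<and>
     v = (\<Sum>\<nu>\<in>Poly_Mapping.keys d. Poly_Mapping.lookup d \<nu>)"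
proof -
  have "v \<in> span (cvec ` columns)" by (simp add: span_cvec)
  then show ?thesis
  proof (induction rule: span_induct_alt)
    case base
    show ?case by (rule exI[of _ 0]) (simp add: weight_space_def act.zero)
  next
    case (step c x y)
    then obtain B where B: "B \<in> columns" "x = cvec B" by blast
    obtain d :: "weight \<Rightarrow>\<^sub>0 'v" where d: "\<And>\<nu>. Poly_Mapping.lookup d \<nu> \<in> weight_space t scale act \<nu>"
      "y = (\<Sum>\<nu>\<in>Poly_Mapping.keys d. Poly_Mapping.lookup d \<nu>)"
      using step by blast
    let ?e = "Poly_Mapping.single (column_wt B) (scale c x)"
    have "Poly_Mapping.lookup (?e + d) \<nu> \<in> weight_space t scale act \<nu>" for \<nu>
      using d(1)[of \<nu>] weight_space_cvec[OF B(1), of c] B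
      by (auto simp: lookup_add lookup_single when_def weight_space_def act.add scale_right_distrib)
    moreover have "(\<Sum>\<nu>\<in>Poly_Mapping.keys (?e + d). Poly_Mapping.lookup (?e + d) \<nu>) = scale c x + y"
    proof -
      have "(\<Sum>\<nu>\<in>Poly_Mapping.keys (?e + d). Poly_Mapping.lookup (?e + d) \<nu>) =
          (\<Sum>\<nu>\<in>Poly_Mapping.keys ?e. Poly_Mapping.lookup ?e \<nu>) +
          (\<Sum>\<nu>\<in>Poly_Mapping.keys d. Poly_Mapping.lookup d \<nu>)"
        by (rule setsum_keys_plus_distrib) auto
      then show ?thesis using d(2) by simp
    qed
    ultimately show ?case by (intro exI[of _ "?e + d"]) simp
  qed
qed

text \<open>The coordinate at A sees only the component of weight \<open>column_wt A\<close>, so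
  every component can be read off the sum.\<close>

lemma weight_decomposition_unique:
  fixes d d' :: "weight \<Rightarrow>\<^sub>0 'v"
  assumes "\<And>\<nu>. Poly_Mapping.lookup d \<nu> \<in> weight_space t scale act \<nu>"
    and "\<And>\<nu>. Poly_Mapping.lookup d' \<nu> \<in> weight_space t scale act \<nu>"
    and "(\<Sum>\<nu>\<in>Poly_Mapping.keys d. Poly_Mapping.lookup d \<nu>) =
      (\<Sum>\<nu>\<in>Poly_Mapping.keys d'. Poly_Mapping.lookup d' \<nu>)"
  shows "d = d'"
proof -
  have *: "coord A (Poly_Mapping.lookup d \<nu>) = (if \<nu> = column_wt A
      then coord A (\<Sum>\<nu>\<in>Poly_Mapping.keys d. Poly_Mapping.lookup d \<nu>) else 0)"
    if d: "\<And>\<nu>. Poly_Mapping.lookup d \<nu> \<in> weight_space t scale act \<nu>" and A: "A \<in> columns"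
    for A \<nu> and d :: "weight \<Rightarrow>\<^sub>0 'v"
  proof (cases "\<nu> = column_wt A")
    case True
    have "(\<Sum>\<mu>\<in>Poly_Mapping.keys d. coord A (Poly_Mapping.lookup d \<mu>)) =
        (\<Sum>\<mu>\<in>Poly_Mapping.keys d. if \<mu> = \<nu> then coord A (Poly_Mapping.lookup d \<mu>) else 0)"
      using weight_space_coord[OF d A] True by (intro sum.cong) auto
    also have "\<dots> = coord A (Poly_Mapping.lookup d \<nu>)"
      by (auto simp: in_keys_iff coord_0)
    finally show ?thesis using True by (simp add: coord_sum)
  next
    case False
    then show ?thesis using weight_space_coord[OF d A] by auto
  qed
  show ?thesis
  proof (rule poly_mapping_eqI, rule coord_eqI)
    fix \<nu> A assume A: "A \<in> columns"
    show "coord A (Poly_Mapping.lookup d \<nu>) = coord A (Poly_Mapping.lookup d' \<nu>)"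
      unfolding *[of d, OF assms(1) A] *[of d', OF assms(2) A] assms(3) ..
  qed
qed

lemma gx_nilpotent: "(act (gx s i 0) ^^ 2) v = 0"
proof -
  have "act (gx s i 0 * gx s i 0) v = 0"
    by (rule linear_eq_0[OF linear_act]) (simp add: act_mult gx_gx_same)
  then show ?thesis by (simp add: act_mult eval_nat_numeral)
qed

lemma integrable: "integrable_module t scale act"
  unfolding integrable_module_def
proof (intro conjI allI uq_module)
  fix v
  show "\<exists>!d :: weight \<Rightarrow>\<^sub>0 'v. (\<forall>\<nu>. Poly_Mapping.lookup d \<nu> \<in> weight_space t scale act \<nu>) \<and>
      v = (\<Sum>\<nu>\<in>Poly_Mapping.keys d. Poly_Mapping.lookup d \<nu>)"
    using weight_decomposition_exists[of v] weight_decomposition_unique by (intro ex_ex1I) auto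
next
  fix s i v
  show "\<exists>n. (act (gx s i 0) ^^ n) v = 0"
    using gx_nilpotent by blast
qed

end

context column_uq_module
begin

subsection \<open>Finite-dimensionality\<close>

lemma finite_dimensional_subspace:
  assumes "subspace W" "finite B" "W \<subseteq> span B"
  shows "finite_dimensional scale W"
proof -
  obtain C where C: "C \<subseteq> W" "independent C" "W \<subseteq> span C"
    using basis_exists[of W] by metis
  have "finite C"
    using independent_span_bound[OF assms(2) C(2)] C(1) assms(3) by blast
  moreover have "W = span C"
    using span_minimal[OF C(1) assms(1)] C(3) by blast
  ultimately show ?thesis unfolding finite_dimensional_def by blast
qed

text \<open>A node i in [c, d] moves entries only between i and i + 1, both in [c, d + 1], and the
  Cartan generators preserve each basis line.\<close>

lemma uq_sub_stable:
  assumes U: "{c..d + 1} \<subseteq> U" and u: "u \<in> uq_sub {c..d}"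
    and v: "v \<in> span (cvec ` {A\<in>columns. A \<subseteq> U})"
  shows "act u v \<in> span (cvec ` {A\<in>columns. A \<subseteq> U})"
  using u v unfolding uq_sub_def
proof (induction arbitrary: v)
  case (1 u)
  have "act u (cvec A) \<in> span (cvec ` {A\<in>columns. A \<subseteq> U})" if A: "A \<in> columns" "A \<subseteq> U" for A
  proof -
    have line: ?thesis if "u \<in> stable_line (cvec A)"
      using that A by (auto simp: stable_line_def intro!: span_scale[OF span_base])
    from 1(1) consider s i r where "u = gx s i r" "i \<in> {c..d}"
      | i m where "u = gh i m" "m \<noteq> 0" | h where "u = gk h"
      by blast
    then show ?thesis
    proof cases
      case 1
      have "move s i A \<subseteq> U" if "movable s i A"
        using A(2) U 1(2) by (cases s) (auto simp: move_def)
      then show ?thesis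
        using A columns_move[OF A(1)]
        by (auto simp: 1 act_gx x_image_def span_zero intro!: span_scale[OF span_base])
    qed (use line stable_line_gh stable_line_gk A in auto)
  qed
  with 1(2) show ?case
    by (induction rule: span_induct_alt) (auto simp: act.add act.scale span_zero intro!: span_add span_scale)
next
  case (2 c)
  then show ?case by (simp add: span_scale)
next
  case (3 u u')
  then show ?case by (simp add: act_add span_add)
next
  case (4 u u')
  then show ?case by (simp add: act_mult)
qed

lemma finite_dimensional_uq_sub: "finite_dimensional scale {act u w | u. u \<in> uq_sub {c..d}}"
proof (rule finite_dimensional_subspace)
  \<comment> \<open>All entries occurring in the support of w together with the window of movable
    positions; a finite set, with finitely many subsets.\<close>
  let ?U = "\<Union> {A\<in>columns. coord A w \<noteq> 0} \<union> {c..d + 1}"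
  let ?B = "{A\<in>columns. A \<subseteq> ?U}"
  have "finite ?U" using finite_coord columns_finite by auto
  then have "finite ?B" by (auto intro: finite_subset[of _ "Pow ?U"])
  then show "finite (cvec ` ?B)" by simp
  have "(\<Sum>A\<in>{A\<in>columns. coord A w \<noteq> 0}. scale (coord A w) (cvec A)) \<in> span (cvec ` ?B)"
    by (intro span_sum span_scale span_base) auto
  then have "w \<in> span (cvec ` ?B)" by (simp only: sum_coord)
  then show "{act u w | u. u \<in> uq_sub {c..d}} \<subseteq> span (cvec ` ?B)"
    using uq_sub_stable[of c d ?U] by blast
  show "subspace {act u w | u. u \<in> uq_sub {c..d}}"
  proof (rule subspaceI)
    have "scal 0 \<in> uq_sub {c..d}" unfolding uq_sub_def by (rule subalgebra_gen.intros(2))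
    then show "0 \<in> {act u w | u. u \<in> uq_sub {c..d}}"
      using act_scal[of 0 w] by force
  next
    fix x y assume "x \<in> {act u w | u. u \<in> uq_sub {c..d}}" "y \<in> {act u w | u. u \<in> uq_sub {c..d}}"
    then obtain u u' where "u \<in> uq_sub {c..d}" "u' \<in> uq_sub {c..d}" "x = act u w" "y = act u' w"
      by blast
    moreover from this have "u + u' \<in> uq_sub {c..d}" "x + y = act (u + u') w"
      by (auto simp: uq_sub_def act_add intro: subalgebra_gen.intros(3))
    ultimately show "x + y \<in> {act u w | u. u \<in> uq_sub {c..d}}"
      by blast
  next
    fix k x assume "x \<in> {act u w | u. u \<in> uq_sub {c..d}}"
    then obtain u where "u \<in> uq_sub {c..d}" "x = act u w" by blast
    moreover from this have "scal k * u \<in> uq_sub {c..d}" "scale k x = act (scal k * u) w"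
      by (auto simp: uq_sub_def act_mult intro: subalgebra_gen.intros(2,4))
    ultimately show "scale k x \<in> {act u w | u. u \<in> uq_sub {c..d}}"
      by blast
  qed
qed

subsection \<open>Extremality\<close>

lemma gx_line:
  assumes A: "A \<in> columns"
  shows "\<exists>c'. \<exists>A'\<in>columns. act (gx s i r) (scale c (cvec A)) = scale c' (cvec A')"
proof (cases "movable s i A")
  case True
  then show ?thesis
    using A columns_move[OF A True] by (auto simp: act.scale act_gx x_image_def)
next
  case False
  then have "act (gx s i r) (scale c (cvec A)) = scale 0 (cvec A)"
    using A by (simp add: act.scale act_gx x_image_def)
  then show ?thesis using A by blast
qed

text \<open>Valid for every exponent, with c' = 0 allowed, so the orbit can be followed without
  computing weights or q-factorials.\<close>

lemma divpow_gx_line: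
  assumes A: "A \<in> columns"
  shows "\<exists>c'. \<exists>A'\<in>columns. act (divpow t (gx s i r) n) (scale c (cvec A)) = scale c' (cvec A')"
proof -
  have "\<exists>c'. \<exists>A'\<in>columns. (act (gx s i r) ^^ n) (scale c (cvec A)) = scale c' (cvec A')"
  proof (induction n)
    case 0
    then show ?case using A by auto
  next
    case (Suc n)
    then show ?case using gx_line by (metis comp_apply funpow.simps(2))
  qed
  then obtain c' A' where "A' \<in> columns" "(act (gx s i r) ^^ n) (scale c (cvec A)) = scale c' (cvec A')"
    by blast
  then have "act (divpow t (gx s i r) n) (scale c (cvec A)) = scale (1 / qfact t n * c') (cvec A')"
    by (simp add: divpow_def act_scal_mult act_power)
  with \<open>A' \<in> columns\<close> show ?thesis by blast
qed

lemma extremal_orbit_line: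
  assumes "A \<in> columns" "u \<in> extremal_orbit t scale act (cvec A)"
  shows "\<exists>c. \<exists>B\<in>columns. u = scale c (cvec B)"
  using assms(2)
proof induction
  case start
  then show ?case using assms(1) by (metis scale_one)
next
  case (step u \<nu> s i)
  then show ?case using divpow_gx_line by metis
qed

lemma i_extremal_line:
  assumes A: "A \<in> columns" shows "i_extremal t scale act i (scale c (cvec A))"
proof -
  have "\<not> movable Plus i A \<or> \<not> movable Minus i A" by (auto simp: movable_def)
  then obtain s where "\<not> movable s i A" by blast
  then have "act (gx s i 0) (scale c (cvec A)) = 0"
    using A by (simp add: act.scale act_gx x_image_def)
  then show ?thesis
    unfolding i_extremal_def using weight_space_cvec[OF A] by blast
qed

lemma extremal_cvec: "A \<in> columns \<Longrightarrow> extremal t scale act (cvec A)"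
  unfolding extremal_def using extremal_orbit_line i_extremal_line by metis

subsection \<open>Cyclicity\<close>

text \<open>At mode 0 the pole contributes the factor 1, so the operator of opposite sign undoes the
  move exactly.\<close>

lemma cyclic_move:
  assumes A: "A \<in> columns" and m: "movable s i A"
  shows "cvec (move s i A) \<in> {act u v | u. True} \<longleftrightarrow> cvec A \<in> {act u v | u. True}"
proof
  assume "cvec A \<in> {act u v | u. True}"
  then obtain u where "cvec A = act u v" by blast
  then have "cvec (move s i A) = act (gx s i 0 * u) v"
    using A m by (simp add: act_mult flip: \<open>cvec A = act u v\<close>) (simp add: act_gx x_image_def)
  then show "cvec (move s i A) \<in> {act u v | u. True}" by blast
next
  assume "cvec (move s i A) \<in> {act u v | u. True}"
  then obtain u where u: "act u v = cvec (move s i A)" by force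
  have "cvec A = act (gx (opp s) i 0 * u) v"
    using columns_move[OF A m] movable_opp_move[OF m] move_opp_move[OF m]
    by (simp add: act_mult u act_gx x_image_def)
  then show "cvec A \<in> {act u v | u. True}" by blast
qed

text \<open>An entry that can be decreased without passing below \<open>m\<close> exists unless the column is the
  interval starting at \<open>m\<close>.\<close>

lemma cyclic_interval:
  assumes A: "A \<in> columns" and m: "\<And>e. e \<in> A \<Longrightarrow> m \<le> e"
  shows "cvec A \<in> {act u v | u. True} \<longleftrightarrow> cvec {m..<m + int l} \<in> {act u v | u. True}"
  using assms
proof (induction "nat (\<Sum>e\<in>A. e - m)" arbitrary: A rule: less_induct)
  case less
  note fin = columns_finite[OF less.prems(1)]
  show ?case
  proof (cases "\<exists>e\<in>A. m < e \<and> e - 1 \<notin> A")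
    case True
    then obtain e where e: "e \<in> A" "m < e" "e - 1 \<notin> A" by blast
    then have mv: "movable Plus (e - 1) A" by (simp add: movable_def)
    let ?A = "move Plus (e - 1) A"
    have ge: "m \<le> x" if "x \<in> ?A" for x
      using that less.prems(2) e by (auto simp: move_def)
    have "(\<Sum>x\<in>?A. x - m) = (\<Sum>x\<in>A. x - m) - 1"
      by (simp add: sum_move[OF fin mv])
    moreover have "0 \<le> (\<Sum>x\<in>?A. x - m)"
      by (intro sum_nonneg) (use ge in auto)
    ultimately have "nat (\<Sum>x\<in>?A. x - m) < nat (\<Sum>x\<in>A. x - m)" by linarith
    from less.hyps[OF this columns_move[OF less.prems(1) mv] ge]
    show ?thesis using cyclic_move[OF less.prems(1) mv] by blast
  next
    case False
    \<comment> \<open>If no entry can be lowered, every entry brings along all integers from m up to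
      itself.\<close>
    have down: "e - int k \<in> A" if "e \<in> A" "m \<le> e - int k" for e k
      using that
    proof (induction k)
      case (Suc k)
      then have "e - int k \<in> A" "m < e - int k" by auto
      then have "e - int k - 1 \<in> A" using False by blast
      moreover have "e - int k - 1 = e - int (Suc k)" by simp
      ultimately show ?case by metis
    qed simp
    have card: "card A = l" using less.prems(1) by (simp add: columns_def)
    have "A \<subseteq> {m..<m + int l}"
    proof
      fix e assume e: "e \<in> A"
      have "{m..e} \<subseteq> A"
      proof
        fix x assume x: "x \<in> {m..e}"
        then show "x \<in> A" using down[OF e, of "nat (e - x)"] by simp
      qed
      then have "card {m..e} \<le> l" using card_mono[OF fin] card by metis
      then show "e \<in> {m..<m + int l}" using less.prems(2)[OF e] by simp
    qed
    then have "A = {m..<m + int l}"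
      using card by (intro card_subset_eq) auto
    then show ?thesis by simp
  qed
qed

lemma interval_in_columns: "{1..int l} \<in> columns"
  by (simp add: columns_def)

lemma cvec_interval: "cvec {1..int l} = b [1..int l]"
  by (simp add: cvec_def)

lemma cyclic: "{act u (cvec {1..int l}) | u. True} = UNIV"
proof -
  let ?W = "{act u (cvec {1..int l}) | u. True}"
  have "cvec A \<in> ?W" if A: "A \<in> columns" for A
  proof -
    \<comment> \<open>A common lower bound for A and for the entries of the generator, so that both
      are linked to the interval starting at m.\<close>
    define m where "m = Min (insert 1 A)"
    have m: "m \<le> e" if "e \<in> insert 1 A" for e
      using that columns_finite[OF A] unfolding m_def by (intro Min_le) auto
    have "cvec {1..int l} \<in> ?W"
      using act_1 by (metis (mono_tags, lifting) mem_Collect_eq)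
    then have "cvec {m..<m + int l} \<in> ?W"
      using cyclic_interval[OF interval_in_columns, of m] m[of 1] by force
    then show ?thesis using cyclic_interval[OF A, of m] m by blast
  qed
  then have *: "cvec ` columns \<subseteq> ?W" by blast
  have "subspace ?W"
  proof (rule subspaceI)
    show "0 \<in> ?W" using act_0[of "cvec {1..int l}"] by (metis (mono_tags, lifting) mem_Collect_eq)
  next
    fix x y assume "x \<in> ?W" "y \<in> ?W"
    then obtain u u' where "x = act u (cvec {1..int l})" "y = act u' (cvec {1..int l})" by blast
    then have "x + y = act (u + u') (cvec {1..int l})" by (simp add: act_add)
    then show "x + y \<in> ?W" by blast
  next
    fix c x assume "x \<in> ?W"
    then obtain u where "x = act u (cvec {1..int l})" by blast
    then have "scale c x = act (scal c * u) (cvec {1..int l})" by (simp add: act_mult)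
    then show "scale c x \<in> ?W" by blast
  qed
  then have "span (cvec ` columns) \<subseteq> ?W"
    using * by (rule span_minimal[rotated])
  then show ?thesis unfolding span_cvec by blast
qed

subsection \<open>The \<open>l\<close>-weight of the generator\<close>

text \<open>The set {1..l} has weight 1 at node l, -1 at node 0 and 0 elsewhere. Its parameters
  there are a q and a q^(l-1); the shift by q^2 turns the latter into (a q^l) q, the argument of psi
  belonging to the inverse of Y_(0, a q^l).\<close>

lemma l_weight_series_interval:
  assumes "l \<ge> 1"
  shows "l_weight_series t (Ymon (int l) a - Ymon 0 (a * exp t ^ l)) s i =
    psi_wt t s (node_wt {1..int l} i) (param {1..int l} i)"
proof -
  let ?m = "Ymon (int l) a - Ymon 0 (a * exp t ^ l)"
  have lookup: "Poly_Mapping.lookup ?m (i, c) =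
      (if i = int l \<and> c = a then 1 else if i = 0 \<and> c = a * exp t ^ l then - 1 else 0)" for c
    using assms by (auto simp: Ymon_def lookup_minus lookup_single when_def)
  consider "i = int l" | "i = 0" | "i \<noteq> int l" "i \<noteq> 0" by blast
  then show ?thesis
  proof cases
    case 1
    then have S: "{c. (i, c) \<in> Poly_Mapping.keys ?m} = {a}"
      using assms unfolding in_keys_iff lookup by auto
    have wt: "node_wt {1..int l} i = 1" using assms 1 by (simp add: node_wt_def)
    have "{x\<in>{1..int l}. x < int l} = {1..<int l}" by auto
    then have "entries_below i {1..int l} = int l - 1"
      using assms 1 by (simp add: entries_below_def)
    then have "param {1..int l} i = a * exp t powi 1"
      unfolding node_param_def by (simp add: 1)
    then have "psi t s (a * exp t) = psi_wt t s 1 (param {1..int l} i)"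
      using psi_eq_psi_wt[OF param_nonzero, of t s "{1..int l}" i] by simp
    then show ?thesis
      unfolding l_weight_series_def S wt using lookup[of a] 1 by simp
  next
    case 2
    then have S: "{c. (i, c) \<in> Poly_Mapping.keys ?m} = {a * exp t ^ l}"
      using assms unfolding in_keys_iff lookup by auto
    have wt: "node_wt {1..int l} i = - 1" using assms 2 by (simp add: node_wt_def)
    have "{x\<in>{1..int l}. x < 0} = {}" by auto
    then have "entries_below i {1..int l} = 0"
      unfolding entries_below_def 2 by (simp only: card.empty of_nat_0)
    then have "param {1..int l} i = a * exp t powi (int l - 1)"
      by (simp add: 2 node_param_def)
    also have "exp t powi (int l - 1) = exp t ^ l / exp t"
      by (simp add: power_int_diff)
    finally have "param {1..int l} i * exp t ^ 2 = a * exp t ^ l * exp t"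
      by (simp add: power2_eq_square)
    then have "inverse (psi t s (a * exp t ^ l * exp t)) = psi_wt t s (- 1) (param {1..int l} i)"
      using inverse_psi_eq_psi_wt[OF param_nonzero, of t s "{1..int l}" i] by simp
    then show ?thesis
      unfolding l_weight_series_def S wt using lookup[of "a * exp t ^ l"] 2 assms
      by (simp add: power_int_def)
  next
    case 3
    then have S: "{c. (i, c) \<in> Poly_Mapping.keys ?m} = {}"
      unfolding in_keys_iff lookup by auto
    have "node_wt {1..int l} i = 0" using 3 by (auto simp: node_wt_def)
    then show ?thesis by (simp add: l_weight_series_def S psi_wt_0)
  qed
qed

lemma l_weight_interval:
  assumes "l \<ge> 1"
  shows "cvec {1..int l} \<in> l_weight_space t scale act (Ymon (int l) a - Ymon 0 (a * exp t ^ l))"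
proof -
  have "((\<lambda>u. act (fps_nth (phi t s i) n) u
      - scale (fps_nth (l_weight_series t (Ymon (int l) a - Ymon 0 (a * exp t ^ l)) s i) n) u) ^^ 1)
      (cvec {1..int l}) = 0" for s i n
    by (simp add: l_weight_series_interval[OF assms] act_phi[OF interval_in_columns])
  then show ?thesis unfolding l_weight_space_def by blast
qed

lemma is_monomial_generator: "is_monomial (Ymon (int l) a - Ymon 0 (a * exp t ^ l))"
  using a_nonzero by (auto simp: is_monomial_def Ymon_def in_keys_iff lookup_minus lookup_single when_def)

lemma elw_generator_interval:
  assumes "l \<ge> 1"
  shows "elw_generator t scale act (Ymon (int l) a - Ymon 0 (a * exp t ^ l)) (cvec {1..int l})"
  unfolding elw_generator_def
  using l_weight_interval[OF assms] cyclic extremal_cvec[OF interval_in_columns]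
    finite_dimensional_uq_sub by blast

lemma cvec_nonzero: "A \<in> columns \<Longrightarrow> cvec A \<noteq> 0"
  using independent_cvec dependent_zero by (metis imageI)

end

theorem theorem3p14:
  fixes t a :: complex and l :: nat
    and scale :: "complex \<Rightarrow> 'v::ab_group_add \<Rightarrow> 'v"
    and b :: "int list \<Rightarrow> 'v"
  assumes q_not_root_of_unity: "\<forall>n>0. exp t ^ n \<noteq> 1"
    and l_pos: "l \<ge> 1"
    and a_nonzero: "a \<noteq> 0"
    and vector_space: "vector_space scale"
    and basis: "tableau_basis scale l b"
  shows "(\<exists>act. is_V_module t l a scale b act) \<and>
    (\<forall>act. is_V_module t l a scale b act \<longrightarrow>
       extremal_loop_weight_module t scale act
         (Ymon (int l) a - Ymon 0 (a * exp t ^ l)) \<and>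
       elw_generator t scale act
         (Ymon (int l) a - Ymon 0 (a * exp t ^ l)) (b [1..int l]) \<and>
       b [1..int l] \<noteq> 0)"
proof -
  interpret tableau_space scale t a l b
    using assms by (simp add: tableau_space_def tableau_space_axioms_def)
  have "extremal_loop_weight_module t scale act (Ymon (int l) a - Ymon 0 (a * exp t ^ l)) \<and>
      elw_generator t scale act (Ymon (int l) a - Ymon 0 (a * exp t ^ l)) (b [1..int l]) \<and>
      b [1..int l] \<noteq> 0" if "column_module act" for act
  proof -
    interpret column_uq_module scale t a l b act
      using that by unfold_locales
    show ?thesis
      using elw_generator_interval[OF l_pos] integrable is_monomial_generator
        cvec_nonzero[OF interval_in_columns]
      unfolding extremal_loop_weight_module_def cvec_interval by blast
  qed
  then show ?thesis
    using column_module_exists by (simp only: is_V_module_iff) blast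
qed

end
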